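(* Let $(X_n,Y_n)_{n\ge 0}$ be the stochastic process generated by the stochastic forward-backward-forward (SFBF) algorithm described in the context, under the assumptions (A1)–(A7) listed there. Then $(X_n)_{n\ge0}$ converges almost surely, as $n\to\infty$, to a limit random variable $X$ with values in the solution set $\mathcal X_*$, and $$\lim_{n\to\infty}\mathbb E\big[r_{\alpha_n}(X_n)^2\big]=0 .$$
   Context: Notation: $\langle\cdot,\cdot\rangle$ and $\|\cdot\|$ are the Euclidean inner product and norm on $\mathbb R^d$; $\Pi_{E}$ is the Euclidean projection onto a nonempty closed convex set $E$. Problem: $\mathcal X\subseteq\mathbb R^d$; $(\Omega,\mathcal F,\mathbb P)$ is a probability space; $\xi$ is a random variable with values in a measurable space $(\Xi,\mathcal A)$ and law $\mathsf P$; $F:\mathbb R^d\times\Xi\to\mathbb R^d$ is such that $F(x,\xi)$ is integrable for each $x$; $T(x):=\mathbb E[F(x,\xi)]$. The solution set is $\mathcal X_*:=\{x^*\in\mathcal X:\langle T(x^* ),x-x^*\rangle\ge 0\ \forall x\in\mathcal X\}$. Assumptions. (A1) $\mathcal X_*\neq\emptyset$. (A2) $\mathcal X$ is nonempty, closed and convex, and $F$ is a Carathéodory map ($F(\cdot,z)$ is continuous for a.e. $z$ and $F(x,\cdot)$ is measurable for all $x$). (A3) $T$ is Lipschitz continuous on $\mathbb R^d$ with modulus $L>0$. (A4) $T$ is pseudo-monotone on $\mathbb R^d$: for all $x,y\in\mathbb R^d$, $\langle T(x),y-x\rangle\ge0$ implies $\langle T(y),y-x\rangle\ge 0$. (A5)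 The step sizes satisfy $0<\underline\alpha:=\inf_{n\ge0}\alpha_n\le\bar\alpha:=\sup_{n\ge0}\alpha_n<\frac1{\sqrt2L}$. (A6) The batch sizes $m_n$ ($n\ge1$) are positive integers with $\sum_{n\ge1}1/m_n<\infty$. (A7) There exist $p\ge2$, $\sigma_0\ge0$ and a measurable locally bounded function $\sigma:\mathcal X_*\to[0,\infty)$ such that for all $x\in\mathbb R^d$ and $x^*\in\mathcal X_*$: $\mathbb E[\|F(x,\xi)-T(x)\|^p]^{1/p}\le\sigma(x^* )+\sigma_0\|x-x^*\|$. SFBF algorithm: $X_0$ is an $\mathbb R^d$-valued random vector; for $n\ge1$, $\xi_n=(\xi_n^{(1)},\dots,\xi_n^{(m_n)})$ and $\eta_n=(\eta_n^{(1)},\dots,\eta_n^{(m_n)})$, where all the $\xi_n^{(i)},\eta_n^{(i)}$ are i.i.d. with law $\mathsf P$ and independent of $X_0$. For $n\ge0$: $A_{n+1}=\frac1{m_{n+1}}\sum_{i=1}^{m_{n+1}}F(X_n,\xi_{n+1}^{(i)})$, $Y_n=\Pi_{\mathcal X}(X_n-\alpha_nA_{n+1})$, $B_{n+1}=\frac1{m_{n+1}}\sum_{i=1}^{m_{n+1}}F(Y_n,\eta_{n+1}^{(i)})$, $X_{n+1}=Y_n+\alpha_n(A_{n+1}-B_{n+1})$. Residual: for $a>0$, $r_a(x):=\|x-\Pi_{\mathcal X}(x-aT(x))\|$.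
   Formalization: The limit of E[r_{α_n}(X_n)^2] is proved assuming E‖X_0‖^2 < ∞; without it the claim fails (X = R, F(x,ξ) = x, α_n = 1/2 gives X_n = (3/4)^n X_0 and infinite expectations). Almost sure convergence is proved for arbitrary X_0. *)

theory Defs
  imports "HOL-Probability.Probability"
begin

definition mean_operator ::
  "'w measure \<Rightarrow> ('w \<Rightarrow> 'z) \<Rightarrow> (real^'d \<Rightarrow> 'z \<Rightarrow> real^'d) \<Rightarrow> real^'d \<Rightarrow> real^'d" where
  "mean_operator M xi F x = (\<integral>\<omega>. F x (xi \<omega>) \<partial>M)"

definition vi_solutions :: "(real^'d) set \<Rightarrow> (real^'d \<Rightarrow> real^'d) \<Rightarrow> (real^'d) set" where
  "vi_solutions K T = {x \<in> K. \<forall>y\<in>K. inner (T x) (y - x) \<ge> 0}"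

definition pseudo_monotone :: "(real^'d \<Rightarrow> real^'d) \<Rightarrow> bool" where
  "pseudo_monotone T \<longleftrightarrow>
     (\<forall>x y. inner (T x) (y - x) \<ge> 0 \<longrightarrow> inner (T y) (y - x) \<ge> 0)"

definition residual ::
  "(real^'d) set \<Rightarrow> (real^'d \<Rightarrow> real^'d) \<Rightarrow> real \<Rightarrow> real^'d \<Rightarrow> real" where
  "residual K T a x = norm (x - closest_point K (x - a *\<^sub>R T x))"

definition minibatch ::
  "(real^'d \<Rightarrow> 'z \<Rightarrow> real^'d) \<Rightarrow> nat \<Rightarrow> (nat \<Rightarrow> 'z) \<Rightarrow> real^'d \<Rightarrow> real^'d" where
  "minibatch F k z x = (1 / real k) *\<^sub>R (\<Sum>i=1..k. F x (z i))"

text \<open>The library's \<open>indep_var\<close> requires both random variables to take values in the same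
  type. The next predicate is independence for different value types: the generated
  sigma-algebras are independent.\<close>

definition indep_rvs ::
  "'w measure \<Rightarrow> 'b measure \<Rightarrow> ('w \<Rightarrow> 'b) \<Rightarrow> 'c measure \<Rightarrow> ('w \<Rightarrow> 'c) \<Rightarrow> bool" where
  "indep_rvs M N V N' W \<longleftrightarrow>
     V \<in> M \<rightarrow>\<^sub>M N \<and> W \<in> M \<rightarrow>\<^sub>M N' \<and>
     prob_space.indep_set M (sets (vimage_algebra (space M) V N))
                            (sets (vimage_algebra (space M) W N'))"

text \<open>The samples are \<open>xs n i\<close> and \<open>es n i\<close> for \<open>n \<ge> 1\<close> and \<open>1 \<le> i \<le> m n\<close>. They are collected
  into one family over a disjoint sum of index sets, so that the \<open>xs\<close>- and \<open>es\<close>-samples are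
  jointly independent.\<close>

definition batch_indices :: "(nat \<Rightarrow> nat) \<Rightarrow> (nat \<times> nat) set" where
  "batch_indices m = (SIGMA n:{1..}. {1..m n})"

definition sample_indices :: "(nat \<Rightarrow> nat) \<Rightarrow> (nat \<times> nat + nat \<times> nat) set" where
  "sample_indices m = batch_indices m <+> batch_indices m"

definition samples ::
  "(nat \<Rightarrow> nat \<Rightarrow> 'w \<Rightarrow> 'z) \<Rightarrow> (nat \<Rightarrow> nat \<Rightarrow> 'w \<Rightarrow> 'z) \<Rightarrow> nat \<times> nat + nat \<times> nat \<Rightarrow> 'w \<Rightarrow> 'z" where
  "samples xs es = case_sum (\<lambda>(n, i). xs n i) (\<lambda>(n, i). es n i)"

end

theory Submission
  imports Defs
begin

text \<open>Let \<open>q\<close> be a solution. Since \<open>T\<close> is Lipschitz and pseudo-monotone and the step sizes stay below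
\<open>1 / (sqrt 2 * L)\<close>, one exact forward-backward-forward step lowers the squared distance of the iterate to \<open>q\<close> by at
least a fixed fraction of \<open>\<parallel>X n - Y n\<parallel>\<^sup>2\<close>. The sampling noise adds a term that is linear in the noise \<open>V n\<close> of the
second minibatch, and terms quadratic in \<open>V n\<close> and in the noise \<open>W n\<close> of the first
(\<open>fbf_step_inequality\<close>). Each minibatch is independent of what was drawn before it, so the linear
term has mean zero, and the quadratic terms have means of order \<open>(1 + \<parallel>X n\<parallel>\<^sup>2) / m (Suc n)\<close>, where the
reciprocals of the batch sizes are summable. Conditioning on the past is expressed by integrating against an arbitrary
weight \<open>h\<close> with values in \<open>[0, 1]\<close> that is measurable for the past. The outcome, \<open>expected_step\<close>, is
\<open>E[h \<parallel>X (Suc n) - q\<parallel>\<^sup>2] + \<delta> E[h \<parallel>X n - Y n\<parallel>\<^sup>2] \<le> (1 + \<gamma> n) E[h \<parallel>X n - q\<parallel>\<^sup>2] + \<gamma> n E[h (1 + \<parallel>q\<parallel>\<^sup>2)]\<close>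
with \<open>\<delta> = 1 - 2 * hi\<^sup>2 * L\<^sup>2 > 0\<close>, where \<open>hi\<close> is an upper bound of the step sizes, and a summable
sequence \<open>\<gamma>\<close>. It holds for every random solution \<open>q\<close> that is known at time \<open>n\<close>.
It is used twice.

With a constant \<open>q\<close> and \<open>h = 1\<close> it shows that the second moments stay bounded and that
\<open>E \<parallel>X n - Y n\<parallel>\<^sup>2\<close> is summable. The residual is at most \<open>\<parallel>X n - Y n\<parallel>\<close> plus noise, so its mean square tends
to zero. On a ball, away from the solution set, the residual is bounded below by compactness;
together with the moment bound this forces the distance of \<open>X n\<close> to the solution set to
tend to zero in probability (\<open>infdist_to_solutions_in_probability\<close>).

For the almost sure convergence, fix a time \<open>n\<close> and let \<open>q\<close> be the solution nearest to \<open>X n\<close>. From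
time \<open>n\<close> on, \<open>\<parallel>X k - q\<parallel>\<^sup>2\<close> is a supermartingale up to summable errors, so a maximal inequality
(\<open>almost_supermartingale_maximal_inequality\<close>) bounds the probability that \<open>X\<close> ever leaves a small ball around \<open>q\<close>.
It starts close to \<open>q\<close> with high probability, by the first part, and the error terms after time \<open>n\<close>
vanish as \<open>n\<close> grows. Hence the path is almost surely Cauchy, and its limit, being a limit of nearest solutions,
is a solution (\<open>AE_converges_to_solution\<close>).

All this is carried out for a map \<open>F\<close> that is continuous in its first argument for every sample
and for a square integrable starting point. The general case follows by setting \<open>F\<close> to zero on a null set of
samples, which changes the process only on a null event, and by cutting \<open>X 0\<close> off outside larger
and larger balls, which leaves the path alone on events that exhaust the space.\<close>

section \<open>Deterministic estimates for one step\<close>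

lemma sq_norm_add_le:
  fixes a b :: "'a::real_inner"
  shows "(norm (a + b))\<^sup>2 \<le> 2 * (norm a)\<^sup>2 + 2 * (norm b)\<^sup>2"
proof -
  have "0 \<le> (norm (a - b))\<^sup>2" by simp
  then show ?thesis
    by (simp add: power2_norm_eq_inner algebra_simps inner_commute)
qed

lemma sq_norm_diff_le:
  fixes a b :: "'a::real_inner"
  shows "(norm (a - b))\<^sup>2 \<le> 2 * (norm a)\<^sup>2 + 2 * (norm b)\<^sup>2"
  using sq_norm_add_le[of a "- b"] by simp

lemma vi_solutions_subset: "vi_solutions K T \<subseteq> K"
  by (auto simp: vi_solutions_def)

text \<open>Pseudo-monotonicity moves \<open>T\<close> from the candidate \<open>x\<close> to the test point \<open>y\<close>. Conversely, testing at
the points \<open>x + t (y - x)\<close>, dividing by \<open>t\<close> and letting \<open>t\<close> tend to zero moves it back. The right-hand side is an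
intersection of half-spaces, so the solution set is convex and has a continuous projection.\<close>
lemma vi_solutions_minty:
  assumes K: "convex K" and T: "continuous_on UNIV T" and mono: "pseudo_monotone T"
  shows "vi_solutions K T = {x \<in> K. \<forall>y\<in>K. inner (T y) (y - x) \<ge> 0}"
proof (intro set_eqI iffI)
  fix x assume "x \<in> vi_solutions K T"
  then show "x \<in> {x \<in> K. \<forall>y\<in>K. inner (T y) (y - x) \<ge> 0}"
    using mono by (auto simp: vi_solutions_def pseudo_monotone_def)
next
  fix x assume x: "x \<in> {x \<in> K. \<forall>y\<in>K. inner (T y) (y - x) \<ge> 0}"
  have "inner (T x) (y - x) \<ge> 0" if y: "y \<in> K" for y
  proof -
    define g where "g t = inner (T (x + t *\<^sub>R (y - x))) (y - x)" for t :: real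
    have g0: "g t \<ge> 0" if t: "t \<in> {0<..<1}" for t
    proof -
      have "x + t *\<^sub>R (y - x) = (1 - t) *\<^sub>R x + t *\<^sub>R y" by (simp add: algebra_simps)
      also have "\<dots> \<in> K" using K x y t by (auto simp: convex_def)
      finally have "inner (T (x + t *\<^sub>R (y - x))) ((x + t *\<^sub>R (y - x)) - x) \<ge> 0" using x by blast
      then show ?thesis using t by (simp add: g_def zero_le_mult_iff)
    qed
    have "continuous_on UNIV g"
      unfolding g_def by (intro continuous_intros continuous_on_compose2[OF T]) auto
    then have "(g \<longlongrightarrow> g 0) (at_right 0)"
      by (auto simp: continuous_on_def intro: tendsto_within_subset)
    moreover have "\<forall>\<^sub>F t in at_right 0. g t \<ge> 0"
      using eventually_at_right_real[of 0 "1::real"] g0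
      by (auto elim!: eventually_mono)
    ultimately have "g 0 \<ge> 0"
      by (intro tendsto_lowerbound[of g _ "at_right 0"]) auto
    then show ?thesis by (simp add: g_def)
  qed
  then show "x \<in> vi_solutions K T" using x by (auto simp: vi_solutions_def)
qed

lemma vi_solutions_closed_convex:
  assumes K: "convex K" "closed K" and T: "continuous_on UNIV T" and mono: "pseudo_monotone T"
  shows "closed (vi_solutions K T)" "convex (vi_solutions K T)"
proof -
  have eq: "vi_solutions K T = K \<inter> (\<Inter>y\<in>K. {x. inner (T y) x \<le> inner (T y) y})"
    unfolding vi_solutions_minty[OF K(1) T mono] by (auto simp: inner_diff_right)
  show "closed (vi_solutions K T)" unfolding eq
    by (intro closed_Int K closed_INT ballI closed_halfspace_le)
  show "convex (vi_solutions K T)" unfolding eq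
    by (intro convex_Int K convex_INT convex_halfspace_le)
qed

lemma residual_zero_imp_solution:
  assumes K: "convex K" "closed K" "K \<noteq> {}" and a: "a > 0" and r: "residual K T a x = 0"
  shows "x \<in> vi_solutions K T"
proof -
  have x: "closest_point K (x - a *\<^sub>R T x) = x" using r by (simp add: residual_def)
  then have xK: "x \<in> K" using closest_point_in_set[OF K(2,3)] by metis
  have "inner (T x) (y - x) \<ge> 0" if "y \<in> K" for y
    using closest_point_dot[OF K(1,2) that, of "x - a *\<^sub>R T x"] a
    by (simp add: x zero_le_mult_iff)
  then show ?thesis using xK by (simp add: vi_solutions_def)
qed

lemma solution_fixed_point:
  assumes K: "convex K" "closed K" and a: "a > 0" and q: "q \<in> vi_solutions K T"
  shows "closest_point K (q - a *\<^sub>R T q) = q"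
proof (rule closest_point_unique[symmetric, OF K])
  show qK: "q \<in> K" using q by (simp add: vi_solutions_def)
  show "\<forall>z\<in>K. dist (q - a *\<^sub>R T q) q \<le> dist (q - a *\<^sub>R T q) z"
  proof
    fix z assume z: "z \<in> K"
    let ?u = "z - q" and ?v = "a *\<^sub>R T q"
    have "inner ?v ?u \<ge> 0" using q z a by (simp add: vi_solutions_def)
    then have "(norm ?v)\<^sup>2 \<le> (norm (?v + ?u))\<^sup>2"
      unfolding power2_norm_eq_inner by (simp add: inner_add_left inner_add_right inner_commute)
    then have "norm ?v \<le> norm (?v + ?u)" by (rule power2_le_imp_le) simp
    also have "norm (?v + ?u) = norm ((q - ?v) - z)" using norm_minus_commute[of "q - ?v" z] by (simp add: algebra_simps)
    finally show "dist (q - ?v) q \<le> dist (q - ?v) z" by (simp add: dist_norm)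
  qed
qed

text \<open>The residual is jointly continuous in the step size and the point, and it vanishes only at
solutions. On a compact set that keeps a distance from the solutions it therefore has a
positive minimum, uniformly in the step sizes.\<close>
lemma residual_bounded_below:
  fixes K :: "(real^'d) set"
  assumes K: "convex K" "closed K" "K \<noteq> {}" and T: "continuous_on UNIV T" and lo: "lo > 0" and d: "d > 0"
  shows "\<exists>\<rho>>0. \<forall>a\<in>{lo..hi}. \<forall>x. norm x \<le> R \<longrightarrow> d \<le> infdist x (vi_solutions K T) \<longrightarrow> \<rho> \<le> residual K T a x"
proof -
  let ?S = "{lo..hi} \<times> (cball 0 R \<inter> {x. d \<le> infdist x (vi_solutions K T)})"
  let ?f = "\<lambda>z. residual K T (fst z) (snd z)"
  have "closed {x. d \<le> infdist x (vi_solutions K T)}"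
    by (intro closed_Collect_le continuous_intros)
  then have cS: "compact ?S"
    by (intro compact_Times compact_Int_closed) auto
  have cf: "continuous_on ?S ?f"
    unfolding residual_def
    by (intro continuous_intros continuous_on_compose2[OF continuous_on_closest_point[OF K, of UNIV]]
       continuous_on_compose2[OF T]) auto
  show ?thesis
  proof (cases "?S = {}")
    case True
    then show ?thesis by (intro exI[of _ 1]) auto
  next
    case False
    from continuous_attains_inf[OF cS this cf] obtain z where z: "z \<in> ?S" "\<And>y. y \<in> ?S \<Longrightarrow> ?f z \<le> ?f y" by blast
    have "?f z \<noteq> 0"
    proof
      assume "?f z = 0"
      with z(1) lo have "snd z \<in> vi_solutions K T" by (intro residual_zero_imp_solution[OF K, of "fst z"]) auto
      with z(1) d show False by auto
    qed
    moreover have "?f z \<ge> 0" by (simp add: residual_def)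
    ultimately have "?f z > 0" by simp
    with z(2) show ?thesis by (intro exI[of _ "?f z"]) auto
  qed
qed

text \<open>Here \<open>w\<close> and \<open>z\<close> are the errors in the evaluations of \<open>T\<close> at \<open>x\<close> and at \<open>y\<close>. The variational
characterization of the projection replaces \<open>a (T x + w)\<close> by \<open>x - y\<close> in the inner product with \<open>y - q\<close>, and
pseudo-monotonicity discards \<open>T y\<close> from it; only \<open>z\<close> survives there. The square of the correction step
costs \<open>2 a\<^sup>2 L\<^sup>2 \<parallel>x - y\<parallel>\<^sup>2\<close>, which is where the bound on the step size enters.\<close>
lemma fbf_step_inequality:
  fixes K :: "(real^'d) set"
  assumes K: "convex K" "closed K" and T: "L-lipschitz_on UNIV T" and mono: "pseudo_monotone T"
    and q: "q \<in> vi_solutions K T" and a: "0 < a" "a \<le> b"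
    and y: "y = closest_point K (x - a *\<^sub>R (T x + w))"
    and x': "x' = y + a *\<^sub>R ((T x + w) - (T y + z))"
  shows "(norm (x' - q))\<^sup>2 \<le> (norm (x - q))\<^sup>2 - (1 - 2 * b\<^sup>2 * L\<^sup>2) * (norm (x - y))\<^sup>2
           - 2 * a * inner z (y - q) + 4 * b\<^sup>2 * ((norm w)\<^sup>2 + (norm z)\<^sup>2)"
proof -
  have qK: "q \<in> K" using q vi_solutions_subset by blast
  then have "K \<noteq> {}" by auto
  have yK: "y \<in> K" unfolding y using closest_point_in_set[OF K(2) \<open>K \<noteq> {}\<close>] .
  have "inner (x - a *\<^sub>R (T x + w) - y) (q - y) \<le> 0"
    using closest_point_dot[OF K qK] unfolding y .
  then have proj: "a * inner (T x + w) (y - q) \<le> inner (x - y) (y - q)"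
    by (simp add: algebra_simps inner_commute)
  have "inner (T q) (y - q) \<ge> 0" using q yK by (simp add: vi_solutions_def)
  then have ps: "a * inner (T y) (y - q) \<ge> 0" using mono a unfolding pseudo_monotone_def by simp
  have e1: "(norm (x' - q))\<^sup>2 = (norm (y - q))\<^sup>2 + 2 * a * inner (T x + w) (y - q)
      - 2 * a * inner (T y) (y - q) - 2 * a * inner z (y - q) + a\<^sup>2 * (norm ((T x + w) - (T y + z)))\<^sup>2"
  proof -
    have "x' - q = (y - q) + a *\<^sub>R ((T x + w) - (T y + z))" by (simp add: x')
    moreover have "(norm (u + a *\<^sub>R v))\<^sup>2 = (norm u)\<^sup>2 + 2 * a * inner v u + a\<^sup>2 * (norm v)\<^sup>2"
      for u v :: "real^'d"
      unfolding power2_norm_eq_inner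
      by (simp add: inner_add_left inner_add_right inner_commute power2_eq_square)
    ultimately have "(norm (x' - q))\<^sup>2 = (norm (y - q))\<^sup>2 + 2 * a * inner ((T x + w) - (T y + z)) (y - q)
        + a\<^sup>2 * (norm ((T x + w) - (T y + z)))\<^sup>2" by metis
    then show ?thesis by (simp add: inner_diff_left inner_add_left algebra_simps)
  qed
  have e2: "2 * inner (x - y) (y - q) = (norm (x - q))\<^sup>2 - (norm (y - q))\<^sup>2 - (norm (x - y))\<^sup>2"
    unfolding power2_norm_eq_inner by (simp add: algebra_simps inner_commute)
  have "norm (T x - T y) \<le> L * norm (x - y)"
    using lipschitz_onD[OF T, of x y] by (simp add: dist_norm)
  then have "(norm (T x - T y))\<^sup>2 \<le> L\<^sup>2 * (norm (x - y))\<^sup>2"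
    using power_mono[of "norm (T x - T y)" "L * norm (x - y)" 2] by (simp add: power_mult_distrib)
  moreover have "(norm ((T x + w) - (T y + z)))\<^sup>2 \<le> 2 * (norm (T x - T y))\<^sup>2 + 2 * (norm (w - z))\<^sup>2"
    using sq_norm_add_le[of "T x - T y" "w - z"] by (simp add: algebra_simps)
  moreover have "(norm (w - z))\<^sup>2 \<le> 2 * (norm w)\<^sup>2 + 2 * (norm z)\<^sup>2" by (rule sq_norm_diff_le)
  ultimately have "(norm ((T x + w) - (T y + z)))\<^sup>2 \<le> 2 * L\<^sup>2 * (norm (x - y))\<^sup>2 + 4 * ((norm w)\<^sup>2 + (norm z)\<^sup>2)"
    by simp
  moreover have "a\<^sup>2 \<le> b\<^sup>2" using a by (simp add: power_mono)
  ultimately have "a\<^sup>2 * (norm ((T x + w) - (T y + z)))\<^sup>2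
     \<le> b\<^sup>2 * (2 * L\<^sup>2 * (norm (x - y))\<^sup>2 + 4 * ((norm w)\<^sup>2 + (norm z)\<^sup>2))"
    by (intro mult_mono) auto
  with e1 e2 proj ps show ?thesis by (simp add: algebra_simps)
qed

text \<open>A solution is a fixed point of the exact forward-backward map, and that map is Lipschitz with constant
\<open>1 + b L \<le> 2\<close>. Hence the second evaluation point \<open>y\<close> is controlled by \<open>x\<close>, so that the variance of the
noise at \<open>y\<close> can be expressed through \<open>x\<close>.\<close>
lemma fb_point_growth:
  fixes K :: "(real^'d) set"
  assumes K: "convex K" "closed K" and T: "L-lipschitz_on UNIV T"
    and q: "q \<in> vi_solutions K T" and a: "0 < a" "a \<le> b" and bL: "b * L \<le> 1"
    and y: "y = closest_point K (x - a *\<^sub>R (T x + w))"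
  shows "(norm y)\<^sup>2 \<le> 2 * (norm q)\<^sup>2 + 16 * (norm (x - q))\<^sup>2 + 4 * b\<^sup>2 * (norm w)\<^sup>2"
proof -
  have "K \<noteq> {}" using q vi_solutions_subset by blast
  have L0: "0 \<le> L" using T by (rule lipschitz_on_nonneg)
  have "norm (y - q) \<le> norm ((x - a *\<^sub>R (T x + w)) - (q - a *\<^sub>R T q))"
    using closest_point_lipschitz[OF K \<open>K \<noteq> {}\<close>, of "x - a *\<^sub>R (T x + w)" "q - a *\<^sub>R T q"]
    by (simp add: y solution_fixed_point[OF K a(1) q] dist_norm)
  also have "\<dots> = norm ((x - q) - a *\<^sub>R (T x - T q) - a *\<^sub>R w)" by (simp add: algebra_simps)
  also have "\<dots> \<le> norm (x - q) + norm (a *\<^sub>R (T x - T q)) + norm (a *\<^sub>R w)"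
    by (intro order_trans[OF norm_triangle_ineq4] add_mono norm_triangle_ineq4 order_refl)
  also have "norm (a *\<^sub>R (T x - T q)) \<le> norm (x - q)"
  proof -
    have "norm (a *\<^sub>R (T x - T q)) \<le> b * (L * norm (x - q))"
      using lipschitz_onD[OF T, of x q] a L0 by (auto simp: dist_norm intro!: mult_mono)
    also have "\<dots> \<le> norm (x - q)" using bL mult_right_mono[OF bL, of "norm (x - q)"] by (simp add: mult.assoc)
    finally show ?thesis .
  qed
  also have "norm (a *\<^sub>R w) \<le> b * norm w" using a by (auto intro: mult_right_mono)
  finally have "norm (y - q) \<le> 2 * norm (x - q) + b * norm w" by simp
  then have "(norm (y - q))\<^sup>2 \<le> (2 * norm (x - q) + b * norm w)\<^sup>2" by (intro power_mono) auto
  also have "\<dots> \<le> 2 * (2 * norm (x - q))\<^sup>2 + 2 * (b * norm w)\<^sup>2"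
    using sq_norm_add_le[of "2 * norm (x - q)" "b * norm w"] by simp
  finally have "(norm (y - q))\<^sup>2 \<le> 8 * (norm (x - q))\<^sup>2 + 2 * b\<^sup>2 * (norm w)\<^sup>2"
    by (simp add: power_mult_distrib)
  moreover have "(norm y)\<^sup>2 \<le> 2 * (norm q)\<^sup>2 + 2 * (norm (y - q))\<^sup>2"
    using sq_norm_add_le[of q "y - q"] by simp
  ultimately show ?thesis by simp
qed

lemma residual_le_step:
  fixes K :: "(real^'d) set"
  assumes K: "convex K" "closed K" "K \<noteq> {}" and a: "0 < a" "a \<le> b"
    and y: "y = closest_point K (x - a *\<^sub>R (T x + w))"
  shows "(residual K T a x)\<^sup>2 \<le> 2 * (norm (x - y))\<^sup>2 + 2 * b\<^sup>2 * (norm w)\<^sup>2"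
proof -
  let ?p = "closest_point K (x - a *\<^sub>R T x)"
  have "(x - a *\<^sub>R (T x + w)) - (x - a *\<^sub>R T x) = - (a *\<^sub>R w)"
    by (simp add: scaleR_add_right)
  then have "norm (y - ?p) \<le> norm (a *\<^sub>R w)"
    using closest_point_lipschitz[OF K, of "x - a *\<^sub>R (T x + w)" "x - a *\<^sub>R T x"]
    unfolding y dist_norm by (metis norm_minus_cancel)
  also have "\<dots> \<le> b * norm w" using a by (auto intro: mult_right_mono)
  finally have "(norm (y - ?p))\<^sup>2 \<le> b\<^sup>2 * (norm w)\<^sup>2"
    using power_mono[of "norm (y - ?p)" "b * norm w" 2] by (simp add: power_mult_distrib)
  moreover have "(residual K T a x)\<^sup>2 \<le> 2 * (norm (x - y))\<^sup>2 + 2 * (norm (y - ?p))\<^sup>2"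
    using sq_norm_add_le[of "x - y" "y - ?p"] by (simp add: residual_def)
  ultimately show ?thesis by simp
qed

text \<open>The sequence \<open>u + B\<close> grows by at most the factor \<open>1 + g k \<le> exp (g k)\<close> in each step.\<close>
lemma discrete_gronwall:
  fixes u g :: "nat \<Rightarrow> real"
  assumes "n \<le> N" and step: "\<And>k. n \<le> k \<Longrightarrow> k < N \<Longrightarrow> u (Suc k) \<le> (1 + g k) * u k + g k * B"
    and g: "\<And>k. g k \<ge> 0" and uB: "\<And>k. u k + B \<ge> 0"
  shows "u N + B \<le> (u n + B) * exp (\<Sum>k=n..<N. g k)"
  using assms(1,2)
proof (induction N rule: dec_induct)
  case base
  then show ?case by simp
next
  case (step N)
  have "u (Suc N) + B \<le> (1 + g N) * (u N + B)"
    using step.prems[of N] step.hyps by (simp add: algebra_simps)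
  also have "\<dots> \<le> exp (g N) * (u N + B)"
    by (intro mult_right_mono uB) (rule exp_ge_add_one_self)
  also have "\<dots> \<le> exp (g N) * ((u n + B) * exp (\<Sum>k=n..<N. g k))"
    using step by (intro mult_left_mono) auto
  finally show ?case using step.hyps by (simp add: exp_add algebra_simps)
qed

section \<open>Measure-theoretic tools\<close>

text \<open>Approximate the first argument by simple functions. For a function with finitely many values in
the first slot, joint measurability is a finite sum, and continuity in \<open>x\<close> passes to the limit.\<close>
lemma caratheodory_measurable:
  fixes F :: "'a::euclidean_space \<Rightarrow> 'z \<Rightarrow> 'b::euclidean_space"
  assumes cont: "\<And>z. z \<in> space S \<Longrightarrow> continuous_on UNIV (\<lambda>x. F x z)"
    and meas [measurable]: "\<And>x. F x \<in> borel_measurable S"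
  shows "(\<lambda>(x, z). F x z) \<in> borel_measurable (borel \<Otimes>\<^sub>M S)"
proof -
  have "(\<lambda>x::'a. x) \<in> borel_measurable borel" by simp
  from borel_measurable_implies_sequence_metric[OF this]
  obtain s :: "nat \<Rightarrow> 'a \<Rightarrow> 'a" where s: "\<And>i. simple_function borel (s i)"
    and lim: "\<And>x. (\<lambda>i. s i x) \<longlonglongrightarrow> x"
    by (metis space_borel UNIV_I)
  have fin: "finite (range (s i))" for i
    using simple_functionD(1)[OF s] by simp
  have [measurable]: "s i -` {c} \<in> sets borel" for i c
    using simple_functionD(2)[OF s, of i "{c}"] by simp
  have eq: "F (s i x) z = (\<Sum>c\<in>range (s i). indicator (s i -` {c}) x *\<^sub>R F c z)" for i x z
  proof -
    have "(\<Sum>c\<in>range (s i). indicator (s i -` {c}) x *\<^sub>R F c z)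
        = (\<Sum>c\<in>range (s i). if c = s i x then F c z else 0)"
      by (intro sum.cong) (auto simp: indicator_def)
    then show ?thesis using fin by simp
  qed
  have "(\<lambda>(x, z). F (s i x) z) \<in> borel_measurable (borel \<Otimes>\<^sub>M S)" for i
    unfolding eq by measurable
  then show ?thesis
  proof (rule borel_measurable_LIMSEQ_metric)
    fix p :: "'a \<times> 'z" assume "p \<in> space (borel \<Otimes>\<^sub>M S)"
    then obtain x :: 'a and z where p: "p = (x, z)" "z \<in> space S" by (auto simp: space_pair_measure)
    have "isCont (\<lambda>x. F x z) x" using cont[OF p(2)] by (simp add: continuous_on_eq_continuous_at)
    then have "(\<lambda>i. F (s i x) z) \<longlonglongrightarrow> F x z" using lim by (rule isCont_tendsto_compose)
    then show "(\<lambda>i. case p of (x, z) \<Rightarrow> F (s i x) z) \<longlonglongrightarrow> (case p of (x, z) \<Rightarrow> F x z)"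
      by (simp add: p)
  qed
qed

definition square_integrable :: "'w measure \<Rightarrow> ('w \<Rightarrow> 'b::euclidean_space) \<Rightarrow> bool" where
  "square_integrable M f \<longleftrightarrow> f \<in> borel_measurable M \<and> integrable M (\<lambda>\<omega>. (norm (f \<omega>))\<^sup>2)"

lemma square_integrable_bound:
  assumes "f \<in> borel_measurable M" "integrable M u" "\<And>\<omega>. \<omega> \<in> space M \<Longrightarrow> (norm (f \<omega>))\<^sup>2 \<le> u \<omega>"
  shows "square_integrable M f"
  unfolding square_integrable_def
proof
  show "integrable M (\<lambda>\<omega>. (norm (f \<omega>))\<^sup>2)"
    using assms(1) by (intro Bochner_Integration.integrable_bound[OF assms(2)])
      (auto intro!: AE_I2 order_trans[OF assms(3)])
qed fact

lemma square_integrable_const [intro, simp]: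
  "finite_measure M \<Longrightarrow> square_integrable M (\<lambda>_. c)"
  by (simp add: square_integrable_def finite_measure.integrable_const)

lemma square_integrable_add [intro]:
  assumes "square_integrable M f" "square_integrable M g"
  shows "square_integrable M (\<lambda>\<omega>. f \<omega> + g \<omega>)"
  by (rule square_integrable_bound[where u = "\<lambda>\<omega>. 2 * (norm (f \<omega>))\<^sup>2 + 2 * (norm (g \<omega>))\<^sup>2"])
     (use assms in \<open>auto simp: square_integrable_def sq_norm_add_le\<close>)

lemma square_integrable_scale [intro]:
  assumes "square_integrable M f"
  shows "square_integrable M (\<lambda>\<omega>. c *\<^sub>R f \<omega>)"
  using assms by (auto simp: square_integrable_def power_mult_distrib)

lemma square_integrable_diff [intro]:
  assumes "square_integrable M f" "square_integrable M g"
  shows "square_integrable M (\<lambda>\<omega>. f \<omega> - g \<omega>)"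
  using square_integrable_add[OF assms(1) square_integrable_scale[OF assms(2), of "-1"]] by simp

lemma square_integrable_sum:
  assumes "finite_measure M" "\<And>i. i \<in> I \<Longrightarrow> square_integrable M (f i)"
  shows "square_integrable M (\<lambda>\<omega>. \<Sum>i\<in>I. f i \<omega>)"
proof (cases "finite I")
  case True
  then show ?thesis using assms(2)
    by (induction I) (auto intro: assms(1))
qed (auto intro: assms(1))

lemma square_integrable_lipschitz_image:
  assumes "finite_measure M" "square_integrable M f" "L-lipschitz_on UNIV T"
  shows "square_integrable M (\<lambda>\<omega>. T (f \<omega>))"
proof -
  interpret finite_measure M by fact
  have L0: "0 \<le> L" using assms(3) by (rule lipschitz_on_nonneg)
  have T: "continuous_on UNIV T" using assms(3) by (rule lipschitz_on_continuous_on)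
  show ?thesis
  proof (rule square_integrable_bound[where u = "\<lambda>\<omega>. 2 * (L\<^sup>2 * (norm (f \<omega>))\<^sup>2) + 2 * (norm (T 0))\<^sup>2"])
    show "(\<lambda>\<omega>. T (f \<omega>)) \<in> borel_measurable M"
      using assms(2) by (auto simp: square_integrable_def intro: borel_measurable_continuous_on[OF T])
    show "integrable M (\<lambda>\<omega>. 2 * (L\<^sup>2 * (norm (f \<omega>))\<^sup>2) + 2 * (norm (T 0))\<^sup>2)"
      using assms(2) by (auto simp: square_integrable_def)
    fix \<omega>
    have "norm (T (f \<omega>) - T 0) \<le> L * norm (f \<omega>)"
      using lipschitz_onD[OF assms(3), of "f \<omega>" 0] by (simp add: dist_norm)
    then have "(norm (T (f \<omega>) - T 0))\<^sup>2 \<le> L\<^sup>2 * (norm (f \<omega>))\<^sup>2"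
      using power_mono[of "norm (T (f \<omega>) - T 0)" "L * norm (f \<omega>)" 2] by (simp add: power_mult_distrib)
    then show "(norm (T (f \<omega>)))\<^sup>2 \<le> 2 * (L\<^sup>2 * (norm (f \<omega>))\<^sup>2) + 2 * (norm (T 0))\<^sup>2"
      using sq_norm_add_le[of "T (f \<omega>) - T 0" "T 0"] by simp
  qed
qed

lemma integrable_weighted:
  fixes h u :: "'w \<Rightarrow> real"
  assumes "integrable M u" "h \<in> borel_measurable M" "\<And>\<omega>. \<bar>h \<omega>\<bar> \<le> 1"
  shows "integrable M (\<lambda>\<omega>. h \<omega> * u \<omega>)"
proof (rule Bochner_Integration.integrable_bound[OF assms(1)])
  show "AE \<omega> in M. norm (h \<omega> * u \<omega>) \<le> norm (u \<omega>)"
    using assms(3) by (auto simp: abs_mult intro!: AE_I2 mult_left_le_one_le)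
qed (use assms in measurable)

lemma square_integrable_weighted:
  fixes h :: "'w \<Rightarrow> real"
  assumes f: "square_integrable M f" and h: "h \<in> borel_measurable M" "\<And>\<omega>. \<bar>h \<omega>\<bar> \<le> 1"
  shows "square_integrable M (\<lambda>\<omega>. h \<omega> *\<^sub>R f \<omega>)"
proof (rule square_integrable_bound[where u = "\<lambda>\<omega>. (norm (f \<omega>))\<^sup>2"])
  show "(norm (h \<omega> *\<^sub>R f \<omega>))\<^sup>2 \<le> (norm (f \<omega>))\<^sup>2" for \<omega>
    using h(2)[of \<omega>] by (intro power_mono) (auto intro: mult_left_le_one_le)
qed (use f h in \<open>auto simp: square_integrable_def\<close>)

lemma integrable_inner:
  fixes f g :: "'w \<Rightarrow> 'b::euclidean_space"
  assumes "square_integrable M f" "square_integrable M g"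
  shows "integrable M (\<lambda>\<omega>. inner (f \<omega>) (g \<omega>))"
proof (rule Bochner_Integration.integrable_bound[where f = "\<lambda>\<omega>. (norm (f \<omega>))\<^sup>2 + (norm (g \<omega>))\<^sup>2"])
  have "\<bar>inner a b\<bar> \<le> (norm a)\<^sup>2 + (norm b)\<^sup>2" for a b :: 'b
  proof -
    have "\<bar>inner a b\<bar> \<le> norm a * norm b" by (rule Cauchy_Schwarz_ineq2)
    also have "\<dots> \<le> 2 * (norm a * norm b)" by simp
    also have "\<dots> \<le> (norm a)\<^sup>2 + (norm b)\<^sup>2"
      using sum_squares_bound[of "norm a" "norm b"] by simp
    finally show ?thesis .
  qed
  then show "AE \<omega> in M. norm (inner (f \<omega>) (g \<omega>)) \<le> norm ((norm (f \<omega>))\<^sup>2 + (norm (g \<omega>))\<^sup>2)"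
    by auto
qed (use assms in \<open>auto simp: square_integrable_def\<close>)

text \<open>The hypothesis \<open>step\<close> says that \<open>V (Suc k)\<close> has conditional expectation at most \<open>(1 + g k) V k + g k B\<close> given
\<open>H k\<close>, tested on the events of \<open>H k\<close>. Stop at the first time from \<open>n\<close> on at which \<open>V\<close> reaches the level \<open>e\<close>: the
quantity \<open>u k\<close> below is the expectation of \<open>V\<close> on the paths of \<open>G\<close> not yet stopped, plus \<open>e\<close> times the
probability of those already stopped. It obeys the same recursion as the expectation of \<open>V\<close> itself, because a
path that stops contributes at least \<open>e\<close>.\<close>
lemma (in prob_space) almost_supermartingale_maximal_inequality:
  fixes V :: "nat \<Rightarrow> 'a \<Rightarrow> real" and H :: "nat \<Rightarrow> 'a measure"
  assumes sub: "\<And>k. subalgebra M (H k)" and mono: "\<And>k. sets (H k) \<subseteq> sets (H (Suc k))"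
    and V: "\<And>k. n \<le> k \<Longrightarrow> V k \<in> borel_measurable (H k)" "\<And>k. n \<le> k \<Longrightarrow> integrable M (V k)"
      "\<And>k \<omega>. 0 \<le> V k \<omega>"
    and step: "\<And>k A. n \<le> k \<Longrightarrow> A \<in> sets (H k) \<Longrightarrow>
       (\<integral>\<omega>. indicator A \<omega> * V (Suc k) \<omega> \<partial>M) \<le> (1 + g k) * (\<integral>\<omega>. indicator A \<omega> * V k \<omega> \<partial>M) + g k * B"
    and G: "G \<in> sets (H n)" and g: "\<And>k. 0 \<le> g k" and B: "0 \<le> B" and e: "0 \<le> e" and nN: "n \<le> N"
  shows "e * prob {\<omega>\<in>G. \<exists>k\<in>{n..N}. e \<le> V k \<omega>} + B
     \<le> ((\<integral>\<omega>. indicator G \<omega> * V n \<omega> \<partial>M) + B) * exp (\<Sum>k=n..<N. g k)"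
proof -
  define S where "S k = {\<omega>\<in>G. \<forall>i\<in>{n..k}. V i \<omega> < e}" for k
  define u where "u k = (\<integral>\<omega>. indicator (S k) \<omega> * V k \<omega> \<partial>M) + e * prob (G - S k)" for k
  have spH: "space (H k) = space M" for k using sub[of k] by (simp add: subalgebra_def)
  have inM: "A \<in> sets (H k) \<Longrightarrow> A \<in> sets M" for A k
    using sub[of k] by (auto simp: subalgebra_def)
  have Sn: "S n = G \<inter> {\<omega>\<in>space (H n). V n \<omega> < e}"
    using sets.sets_into_space[OF G] by (auto simp: S_def)
  have SSuc: "S (Suc k) = S k \<inter> {\<omega>\<in>space (H (Suc k)). V (Suc k) \<omega> < e}" if "n \<le> k" for k
    using sets.sets_into_space[OF G] spH that by (auto simp: S_def le_Suc_eq)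
  have SH: "S k \<in> sets (H k)" if "n \<le> k" for k
    using that
  proof (induction k rule: dec_induct)
    case base
    show ?case unfolding Sn using G V(1)[of n] by (intro sets.Int) auto
  next
    case (step k)
    show ?case unfolding SSuc[OF step.hyps(1)]
      using step mono[of k] V(1)[of "Suc k"] by (intro sets.Int) auto
  qed
  note SM = inM[OF SH] and GM = inM[OF G]
  have ind: "integrable M (\<lambda>\<omega>. indicator A \<omega> * V k \<omega>)" if "A \<in> sets M" "n \<le> k" for A k
    using that by (intro integrable_weighted V) (auto simp: indicator_def)
  have ind_int: "(\<integral>\<omega>. indicator (A::'a set) \<omega> * V k \<omega> + e * indicator C \<omega> \<partial>M)
      = (\<integral>\<omega>. indicator A \<omega> * V k \<omega> \<partial>M) + e * prob C"
    if "A \<in> sets M" "C \<in> sets M" "n \<le> k" for A C k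
    using that ind[OF that(1,3)] by (subst Bochner_Integration.integral_add) (auto simp: integrable_real_mult_indicator less_top[symmetric])
  have "u N + B \<le> (u n + B) * exp (\<Sum>k=n..<N. g k)"
  proof (rule discrete_gronwall[OF nN])
    fix k assume k: "n \<le> k" "k < N"
    have "u (Suc k) = (\<integral>\<omega>. indicator (S (Suc k)) \<omega> * V (Suc k) \<omega> + e * indicator (G - S (Suc k)) \<omega> \<partial>M)"
      unfolding u_def using k SM GM by (intro ind_int[symmetric]) auto
    also have "\<dots> \<le> (\<integral>\<omega>. indicator (S k) \<omega> * V (Suc k) \<omega> + e * indicator (G - S k) \<omega> \<partial>M)"
    proof (rule integral_mono)
      fix \<omega> assume w: "\<omega> \<in> space M"
      show "indicator (S (Suc k)) \<omega> * V (Suc k) \<omega> + e * indicator (G - S (Suc k)) \<omega>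
        \<le> indicator (S k) \<omega> * V (Suc k) \<omega> + e * indicator (G - S k) \<omega>"
        using V(3)[of "Suc k" \<omega>] w k by (auto simp: SSuc spH indicator_def)
    qed (use k SM GM in \<open>auto intro!: Bochner_Integration.integrable_add ind integrable_real_mult_indicator simp: less_top[symmetric]\<close>)
    also have "\<dots> = (\<integral>\<omega>. indicator (S k) \<omega> * V (Suc k) \<omega> \<partial>M) + e * prob (G - S k)"
      using k SM GM by (intro ind_int) auto
    also have "\<dots> \<le> ((1 + g k) * (\<integral>\<omega>. indicator (S k) \<omega> * V k \<omega> \<partial>M) + g k * B) + e * prob (G - S k)"
      using step[OF k(1) SH[OF k(1)]] by simp
    also have "\<dots> \<le> (1 + g k) * u k + g k * B"
      using g[of k] e by (simp add: u_def algebra_simps)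
    finally show "u (Suc k) \<le> (1 + g k) * u k + g k * B" .
  next
    show "u k + B \<ge> 0" for k
      unfolding u_def using V(3) B e by (intro add_nonneg_nonneg integral_nonneg) auto
  qed (rule g)
  moreover have "u n \<le> (\<integral>\<omega>. indicator G \<omega> * V n \<omega> \<partial>M)"
  proof -
    have "u n = (\<integral>\<omega>. indicator (S n) \<omega> * V n \<omega> + e * indicator (G - S n) \<omega> \<partial>M)"
      unfolding u_def using SM GM by (intro ind_int[symmetric]) auto
    also have "\<dots> \<le> (\<integral>\<omega>. indicator G \<omega> * V n \<omega> \<partial>M)"
    proof (rule integral_mono)
      fix \<omega>
      show "indicator (S n) \<omega> * V n \<omega> + e * indicator (G - S n) \<omega> \<le> indicator G \<omega> * V n \<omega>"
        by (auto simp: S_def indicator_def)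
    qed (use SM GM in \<open>auto intro!: Bochner_Integration.integrable_add ind integrable_real_mult_indicator simp: less_top[symmetric]\<close>)
    finally show ?thesis .
  qed
  then have "(u n + B) * exp (\<Sum>k=n..<N. g k) \<le> ((\<integral>\<omega>. indicator G \<omega> * V n \<omega> \<partial>M) + B) * exp (\<Sum>k=n..<N. g k)"
    by (intro mult_right_mono) auto
  moreover have "e * prob {\<omega>\<in>G. \<exists>k\<in>{n..N}. e \<le> V k \<omega>} \<le> u N"
  proof -
    have "{\<omega>\<in>G. \<exists>k\<in>{n..N}. e \<le> V k \<omega>} = G - S N" by (auto simp: S_def not_less)
    then show ?thesis unfolding u_def using V(3) by (auto intro!: integral_nonneg)
  qed
  ultimately show ?thesis by linarith
qed

text \<open>The reference point \<open>q n\<close> may change with \<open>n\<close>: for a fixed tolerance the bad event at time \<open>n\<close> contains the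
intersection over all times, whose probability is therefore zero, and countably many tolerances
suffice.\<close>
lemma (in prob_space) AE_eventually_close:
  fixes X q :: "nat \<Rightarrow> 'a \<Rightarrow> 'b::{metric_space, second_countable_topology}"
  assumes [measurable]: "\<And>n. X n \<in> borel_measurable M" "\<And>n. q n \<in> borel_measurable M"
    and lim: "\<And>e. e > 0 \<Longrightarrow> (\<lambda>n. prob {\<omega>\<in>space M. \<exists>k\<ge>n. e \<le> dist (X k \<omega>) (q n \<omega>)}) \<longlonglongrightarrow> 0"
  shows "AE \<omega> in M. \<forall>e>0. \<exists>n. \<forall>k\<ge>n. dist (X k \<omega>) (q n \<omega>) < e"
proof -
  have "AE \<omega> in M. \<exists>n. \<forall>k\<ge>n. dist (X k \<omega>) (q n \<omega>) < 1 / real (Suc j)" for j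
  proof -
    define N where "N n = {\<omega>\<in>space M. \<exists>k\<ge>n. 1 / real (Suc j) \<le> dist (X k \<omega>) (q n \<omega>)}" for n
    have [measurable]: "N n \<in> sets M" for n unfolding N_def by measurable
    have "prob (\<Inter>n. N n) \<le> prob (N n)" for n by (intro finite_measure_mono) auto
    then have "prob (\<Inter>n. N n) \<le> 0"
      by (intro LIMSEQ_le_const[OF lim[of "1 / real (Suc j)", folded N_def]]) auto
    then have "prob (\<Inter>n. N n) = 0" by (simp add: measure_le_0_iff)
    then have "(\<Inter>n. N n) \<in> null_sets M"
      by (auto simp: emeasure_eq_measure intro!: null_setsI)
    then have "AE \<omega> in M. \<omega> \<notin> (\<Inter>n. N n)" by (rule AE_not_in)
    then show ?thesis using AE_space by eventually_elim (simp add: N_def, meson not_le)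
  qed
  then have "AE \<omega> in M. \<forall>j. \<exists>n. \<forall>k\<ge>n. dist (X k \<omega>) (q n \<omega>) < 1 / real (Suc j)"
    by (simp add: AE_all_countable)
  then show ?thesis
  proof eventually_elim
    case (elim \<omega>)
    show ?case
    proof (intro allI impI)
      fix e :: real assume "e > 0"
      then obtain j where "1 / real (Suc j) < e" using nat_approx_posE by blast
      then show "\<exists>n. \<forall>k\<ge>n. dist (X k \<omega>) (q n \<omega>) < e" using elim by (meson less_trans)
    qed
  qed
qed

lemma convergent_to_closed_if_eventually_close:
  fixes x q :: "nat \<Rightarrow> 'b::complete_space"
  assumes C: "closed C" "\<And>n. q n \<in> C" and close: "\<And>e. e > 0 \<Longrightarrow> \<exists>n. \<forall>k\<ge>n. dist (x k) (q n) < e"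
  shows "\<exists>l\<in>C. x \<longlonglongrightarrow> l"
proof -
  have "Cauchy x"
  proof (rule metric_CauchyI)
    fix e :: real assume "e > 0"
    then obtain n where n: "\<And>k. k \<ge> n \<Longrightarrow> dist (x k) (q n) < e / 2" using close[of "e / 2"] by auto
    show "\<exists>M. \<forall>m\<ge>M. \<forall>n\<ge>M. dist (x m) (x n) < e"
      using n by (intro exI[of _ n]) (meson dist_triangle_half_r dist_triangle_half_l)
  qed
  then obtain l where l: "x \<longlonglongrightarrow> l" using Cauchy_convergent convergent_def by blast
  have "\<exists>y\<in>C. dist y l < e" if e: "e > 0" for e
  proof -
    obtain n where n: "\<And>k. k \<ge> n \<Longrightarrow> dist (x k) (q n) < e / 2" using close[of "e / 2"] e by auto
    have "(\<lambda>k. dist (x k) (q n)) \<longlonglongrightarrow> dist l (q n)" by (intro tendsto_intros l)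
    then have "dist l (q n) \<le> e / 2"
      by (rule LIMSEQ_le_const2) (use n in \<open>auto intro!: exI[of _ n] less_imp_le\<close>)
    then show ?thesis using C(2)[of n] e by (intro bexI[of _ "q n"]) (auto simp: dist_commute)
  qed
  then have "l \<in> closure C" by (simp add: closure_approachable)
  then show ?thesis using C(1) l by auto
qed

section \<open>Independence of the past and a fresh sample\<close>

locale independent_samples = prob_space M
  for M :: "'w measure" +
  fixes N :: "'b measure" and X0 :: "'w \<Rightarrow> 'b"
    and S :: "'z measure" and P :: "'z measure" and J :: "'j set" and Z :: "'j \<Rightarrow> 'w \<Rightarrow> 'z"
  assumes samples: "indep_vars (\<lambda>_. S) Z J"
    and law: "\<And>j. j \<in> J \<Longrightarrow> distr M S (Z j) = P"
    and start: "indep_rvs M N X0 (PiM J (\<lambda>_. S)) (\<lambda>\<omega>. \<lambda>j\<in>J. Z j \<omega>)"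
begin

text \<open>The starting point and the samples take values in different types. Their generated events live
in one type, so joint independence is stated for families of events, with \<open>None\<close> standing for
the starting point.\<close>
definition source_events :: "'j option \<Rightarrow> 'w set set" where
  "source_events i = (case i of None \<Rightarrow> {X0 -` A \<inter> space M | A. A \<in> sets N}
     | Some j \<Rightarrow> {Z j -` A \<inter> space M | A. A \<in> sets S})"

definition past :: "'j set \<Rightarrow> 'w measure" where
  "past I = sigma (space M) (\<Union>i\<in>insert None (Some ` I). source_events i)"

lemma Z_measurable: "j \<in> J \<Longrightarrow> Z j \<in> M \<rightarrow>\<^sub>M S"
  using samples by (simp add: indep_vars_def2)

lemma X0_measurable: "X0 \<in> M \<rightarrow>\<^sub>M N"
  using start by (simp add: indep_rvs_def)

lemma source_events_sets: "i \<in> insert None (Some ` J) \<Longrightarrow> source_events i \<subseteq> sets M"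
  using Z_measurable X0_measurable by (auto simp: source_events_def)

lemma source_events_space: "source_events i \<subseteq> Pow (space M)"
  by (auto simp: source_events_def split: option.splits)

lemma space_past [simp]: "space (past I) = space M"
  unfolding past_def using source_events_space by (intro space_measure_of) blast

lemma sets_past: "sets (past I) = sigma_sets (space M) (\<Union>i\<in>insert None (Some ` I). source_events i)"
  unfolding past_def using source_events_space by (intro sets_measure_of) blast

lemma past_mono: "I \<subseteq> I' \<Longrightarrow> sets (past I) \<subseteq> sets (past I')"
  unfolding sets_past by (intro sigma_sets_subseteq) auto

lemma subalgebra_past:
  assumes "I \<subseteq> J"
  shows "subalgebra M (past I)"
  unfolding subalgebra_def space_past sets_past
  using source_events_sets assms by (intro conjI refl sets.sigma_sets_subset UN_least) auto

lemma measurable_past_mono: "I \<subseteq> I' \<Longrightarrow> f \<in> past I \<rightarrow>\<^sub>M N' \<Longrightarrow> f \<in> past I' \<rightarrow>\<^sub>M N'"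
  using past_mono[of I I'] by (auto simp: measurable_def)

lemma X0_measurable_past: "X0 \<in> past I \<rightarrow>\<^sub>M N"
proof (rule measurableI)
  show "\<omega> \<in> space (past I) \<Longrightarrow> X0 \<omega> \<in> space N" for \<omega>
    using measurable_space[OF X0_measurable] by simp
  show "X0 -` A \<inter> space (past I) \<in> sets (past I)" if "A \<in> sets N" for A
    unfolding sets_past using that by (intro sigma_sets.Basic) (auto simp: source_events_def)
qed

lemma Z_measurable_past:
  assumes "j \<in> I" "I \<subseteq> J"
  shows "Z j \<in> past I \<rightarrow>\<^sub>M S"
proof (rule measurableI)
  show "\<omega> \<in> space (past I) \<Longrightarrow> Z j \<omega> \<in> space S" for \<omega>
    using measurable_space[OF Z_measurable] assms by auto
  show "Z j -` A \<inter> space (past I) \<in> sets (past I)" if "A \<in> sets S" for A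
    unfolding sets_past using that assms by (intro sigma_sets.Basic) (auto simp: source_events_def)
qed

text \<open>A finite intersection of events of samples is an event of the whole sample vector, from which the
starting point is independent; the samples among themselves are independent by assumption.\<close>
lemma indep_source_events: "indep_sets source_events (insert None (Some ` J))"
proof (rule indep_setsI[OF source_events_sets])
  fix A L assume L: "L \<noteq> {}" "L \<subseteq> insert None (Some ` J)" "finite L" and A: "\<forall>i\<in>L. A i \<in> source_events i"
  define L' where "L' = {j. Some j \<in> L}"
  have L': "finite L'" "L' \<subseteq> J" "L - {None} = Some ` L'"
  proof -
    have "L' = Some -` L" by (auto simp: L'_def)
    then show "finite L'" using finite_vimageI[OF L(3), of Some] by simp
    show "L' \<subseteq> J" using L(2) by (auto simp: L'_def)
    show "L - {None} = Some ` L'"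
    proof (intro set_eqI)
      show "i \<in> L - {None} \<longleftrightarrow> i \<in> Some ` L'" for i by (cases i) (auto simp: L'_def)
    qed
  qed
  define E where "E = (\<Inter>j\<in>L'. A (Some j)) \<inter> space M"
  have "\<exists>B. A (Some j) = Z j -` B \<inter> space M \<and> B \<in> sets S" if "j \<in> L'" for j
    using A that by (auto simp: L'_def source_events_def)
  then obtain B where B: "\<And>j. j \<in> L' \<Longrightarrow> A (Some j) = Z j -` B j \<inter> space M" "\<And>j. j \<in> L' \<Longrightarrow> B j \<in> sets S"
    by metis
  have pE: "prob E = (\<Prod>j\<in>L'. prob (A (Some j)))"
  proof (cases "L' = {}")
    case True
    then show ?thesis by (simp add: E_def prob_space)
  next
    case False
    have "E = (\<Inter>j\<in>L'. A (Some j))" using False B(1) by (auto simp: E_def)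
    moreover have "prob (\<Inter>j\<in>L'. A (Some j)) = (\<Prod>j\<in>L'. prob (A (Some j)))"
      using samples L' False B unfolding indep_vars_def2
      by (intro indep_setsD[where F = "\<lambda>i. {Z i -` A \<inter> space M |A. A \<in> sets S}" and I = J]) auto
    ultimately show ?thesis by simp
  qed
  let ?W = "\<lambda>\<omega>. \<lambda>j\<in>J. Z j \<omega>"
  show "prob (\<Inter>i\<in>L. A i) = (\<Prod>i\<in>L. prob (A i))"
  proof (cases "None \<in> L")
    case False
    then have "L = Some ` L'" using L' by auto
    moreover from this have "(\<Inter>i\<in>L. A i) = E" using L(1) B(1) by (auto simp: E_def)
    ultimately show ?thesis using pE by (simp add: prod.reindex)
  next
    case True
    have L_eq: "L = insert None (Some ` L')" using L' True by auto
    have subN: "A None \<subseteq> space M" using A True source_events_space by blast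
    then have "(\<Inter>i\<in>L. A i) = A None \<inter> E" unfolding L_eq by (auto simp: E_def)
    moreover have "prob (A None \<inter> E) = prob (A None) * prob E"
    proof (rule indep_setD)
      show "indep_set (sets (vimage_algebra (space M) X0 N)) (sets (vimage_algebra (space M) ?W (PiM J (\<lambda>_. S))))"
        using start by (simp add: indep_rvs_def)
      show "A None \<in> sets (vimage_algebra (space M) X0 N)"
        using bspec[OF A True] by (auto simp: source_events_def intro: in_vimage_algebra)
      have "{f\<in>space (PiM J (\<lambda>_. S)). \<forall>j\<in>L'. f j \<in> B j} \<in> sets (PiM J (\<lambda>_. S))"
      proof (rule sets.sets_Collect_finite_All[OF _ L'(1)])
        fix j assume j: "j \<in> L'"
        then have "(\<lambda>f. f j) -` B j \<inter> space (PiM J (\<lambda>_. S)) \<in> sets (PiM J (\<lambda>_. S))"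
          using L'(2) by (intro measurable_sets[OF measurable_component_singleton] B(2)) auto
        also have "(\<lambda>f. f j) -` B j \<inter> space (PiM J (\<lambda>_. S)) = {f\<in>space (PiM J (\<lambda>_. S)). f j \<in> B j}"
          by auto
        finally show "{f\<in>space (PiM J (\<lambda>_. S)). f j \<in> B j} \<in> sets (PiM J (\<lambda>_. S))" .
      qed
      then have "?W -` {f\<in>space (PiM J (\<lambda>_. S)). \<forall>j\<in>L'. f j \<in> B j} \<inter> space M
          \<in> sets (vimage_algebra (space M) ?W (PiM J (\<lambda>_. S)))"
        by (rule in_vimage_algebra)
      also have "?W -` {f\<in>space (PiM J (\<lambda>_. S)). \<forall>j\<in>L'. f j \<in> B j} \<inter> space M = E"
        using L'(2) B(1) measurable_space[OF Z_measurable] by (auto simp: E_def space_PiM)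
      finally show "E \<in> sets (vimage_algebra (space M) ?W (PiM J (\<lambda>_. S)))" .
    qed
    ultimately show ?thesis using pE L'(1) unfolding L_eq by (simp add: prod.reindex)
  qed
qed

lemma past_indep_sample:
  assumes I: "I \<subseteq> J" and j: "j \<in> J - I" and a: "a \<in> sets (past I)" and b: "B \<in> sets S"
  shows "prob (a \<inter> (Z j -` B \<inter> space M)) = prob a * prob (Z j -` B \<inter> space M)"
proof -
  let ?I = "\<lambda>b. if b then insert None (Some ` I) else {Some j}"
  have "indep_sets (\<lambda>b. sigma_sets (space M) (\<Union>i\<in>?I b. source_events i)) (UNIV :: bool set)"
  proof (rule indep_sets_collect_sigma)
    show "indep_sets source_events (\<Union>b\<in>UNIV. ?I b)"
      by (rule indep_sets_mono_index[OF _ indep_source_events]) (use I j in \<open>auto split: if_splits\<close>)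
    show "disjoint_family_on ?I UNIV"
      using j by (auto simp: disjoint_family_on_def)
    show "Int_stable (source_events i)" for i
    proof (rule Int_stableI)
      have stable: "X -` A \<inter> space M \<inter> (X -` B \<inter> space M) \<in> {X -` A \<inter> space M |A. A \<in> sets Q}"
        if "A \<in> sets Q" "B \<in> sets Q" for X :: "'w \<Rightarrow> 'q" and Q :: "'q measure" and A B
        using that by (intro CollectI exI[of _ "A \<inter> B"]) auto
      fix a b assume "a \<in> source_events i" "b \<in> source_events i"
      then show "a \<inter> b \<in> source_events i"
        by (cases i) (auto simp: source_events_def intro: stable[simplified])
    qed
  qed
  moreover have "Z j -` B \<inter> space M \<in> source_events (Some j)"
    using b by (auto simp: source_events_def)
  ultimately show ?thesis
    using indep_setsD[of _ UNIV UNIV "\<lambda>b. if b then a else Z j -` B \<inter> space M"] a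
    by (simp add: UNIV_bool sets_past sigma_sets.Basic Int_commute mult.commute)
qed

lemma prob_space_P: "j \<in> J \<Longrightarrow> prob_space P"
  using prob_space_distr[OF Z_measurable] law by metis

lemma sets_P: "j \<in> J \<Longrightarrow> sets P = sets S"
  using law[of j] by auto

text \<open>Anything known from the samples in \<open>I\<close> has, together with a further sample, a product law.
The two lemmas that follow are the resulting forms of Fubini's theorem: a fresh sample may be integrated out first.\<close>
lemma distr_past_sample:
  assumes I: "I \<subseteq> J" and j: "j \<in> J - I" and U: "U \<in> past I \<rightarrow>\<^sub>M N'"
  shows "distr M (N' \<Otimes>\<^sub>M S) (\<lambda>\<omega>. (U \<omega>, Z j \<omega>)) = distr M N' U \<Otimes>\<^sub>M P"
proof (rule pair_measure_eqI[symmetric])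
  have UM [measurable]: "U \<in> M \<rightarrow>\<^sub>M N'" using measurable_from_subalg[OF subalgebra_past[OF I] U] .
  have ZM [measurable]: "Z j \<in> M \<rightarrow>\<^sub>M S" using Z_measurable j by simp
  show "sigma_finite_measure (distr M N' U)" "sigma_finite_measure P"
    using prob_space_distr[OF UM] prob_space_P[of j] j
    by (auto intro: prob_space_imp_sigma_finite)
  show "sets (distr M N' U \<Otimes>\<^sub>M P) = sets (distr M (N' \<Otimes>\<^sub>M S) (\<lambda>\<omega>. (U \<omega>, Z j \<omega>)))"
    using sets_P[of j] j by (auto cong: sets_pair_measure_cong)
  fix A B assume A: "A \<in> sets (distr M N' U)" and B: "B \<in> sets P"
  then have AB [measurable]: "A \<in> sets N'" "B \<in> sets S" using sets_P[of j] j by auto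
  have "emeasure P B = emeasure M (Z j -` B \<inter> space M)"
    using law[of j] j AB by (metis DiffD1 ZM emeasure_distr)
  moreover have "emeasure (distr M N' U) A = emeasure M (U -` A \<inter> space M)"
    using AB by (simp add: emeasure_distr)
  moreover have "emeasure (distr M (N' \<Otimes>\<^sub>M S) (\<lambda>\<omega>. (U \<omega>, Z j \<omega>))) (A \<times> B)
     = emeasure M ((U -` A \<inter> space M) \<inter> (Z j -` B \<inter> space M))"
    by (subst emeasure_distr) (auto intro!: arg_cong[where f = "emeasure M"])
  moreover have "U -` A \<inter> space M \<in> sets (past I)"
    using measurable_sets[OF U AB(1)] by simp
  ultimately show "emeasure (distr M N' U) A * emeasure P B
     = emeasure (distr M (N' \<Otimes>\<^sub>M S) (\<lambda>\<omega>. (U \<omega>, Z j \<omega>))) (A \<times> B)"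
    using past_indep_sample[OF I j _ AB(2)]
    by (simp add: emeasure_eq_measure ennreal_mult'')
qed

lemma nn_integral_past_sample:
  assumes I: "I \<subseteq> J" and j: "j \<in> J - I" and U: "U \<in> past I \<rightarrow>\<^sub>M N'"
    and f: "f \<in> borel_measurable (N' \<Otimes>\<^sub>M S)"
  shows "(\<integral>\<^sup>+\<omega>. f (U \<omega>, Z j \<omega>) \<partial>M) = (\<integral>\<^sup>+\<omega>. \<integral>\<^sup>+z. f (U \<omega>, z) \<partial>P \<partial>M)"
proof -
  have UM [measurable]: "U \<in> M \<rightarrow>\<^sub>M N'" using measurable_from_subalg[OF subalgebra_past[OF I] U] .
  have ZM [measurable]: "Z j \<in> M \<rightarrow>\<^sub>M S" using Z_measurable j by simp
  interpret P: prob_space P using prob_space_P[of j] j by simp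
  have sP: "sets P = sets S" using sets_P[of j] j by simp
  have f1: "f \<in> borel_measurable (distr M N' U \<Otimes>\<^sub>M P)"
    using f by (simp add: sP cong: measurable_cong_sets sets_pair_measure_cong)
  have f2: "f \<in> borel_measurable (N' \<Otimes>\<^sub>M P)"
    using f by (simp add: sP cong: measurable_cong_sets sets_pair_measure_cong)
  have "(\<integral>\<^sup>+\<omega>. f (U \<omega>, Z j \<omega>) \<partial>M) = integral\<^sup>N (distr M (N' \<Otimes>\<^sub>M S) (\<lambda>\<omega>. (U \<omega>, Z j \<omega>))) f"
    using f by (subst nn_integral_distr) auto
  also have "\<dots> = (\<integral>\<^sup>+u. \<integral>\<^sup>+z. f (u, z) \<partial>P \<partial>distr M N' U)"
    unfolding distr_past_sample[OF I j U] by (rule P.nn_integral_fst[OF f1, symmetric])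
  also have "\<dots> = (\<integral>\<^sup>+\<omega>. \<integral>\<^sup>+z. f (U \<omega>, z) \<partial>P \<partial>M)"
    using P.borel_measurable_nn_integral_fst[OF f2] by (subst nn_integral_distr) auto
  finally show ?thesis .
qed

lemma integral_past_sample_eq_0:
  fixes f :: "_ \<Rightarrow> real"
  assumes I: "I \<subseteq> J" and j: "j \<in> J - I" and U: "U \<in> past I \<rightarrow>\<^sub>M N'"
    and f: "f \<in> borel_measurable (N' \<Otimes>\<^sub>M S)" and int: "integrable M (\<lambda>\<omega>. f (U \<omega>, Z j \<omega>))"
    and zero: "\<And>u. (\<integral>z. f (u, z) \<partial>P) = 0"
  shows "(\<integral>\<omega>. f (U \<omega>, Z j \<omega>) \<partial>M) = 0"
proof -
  have UM [measurable]: "U \<in> M \<rightarrow>\<^sub>M N'" using measurable_from_subalg[OF subalgebra_past[OF I] U] .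
  have ZM [measurable]: "Z j \<in> M \<rightarrow>\<^sub>M S" using Z_measurable j by simp
  interpret P: prob_space P using prob_space_P[of j] j by simp
  interpret U: prob_space "distr M N' U" by (rule prob_space_distr) measurable
  interpret UP: pair_sigma_finite "distr M N' U" P ..
  have "integrable (distr M (N' \<Otimes>\<^sub>M S) (\<lambda>\<omega>. (U \<omega>, Z j \<omega>))) f"
    using int f by (subst integrable_distr_eq) auto
  then have int': "integrable (distr M N' U \<Otimes>\<^sub>M P) f" unfolding distr_past_sample[OF I j U] .
  have "(\<integral>\<omega>. f (U \<omega>, Z j \<omega>) \<partial>M) = integral\<^sup>L (distr M (N' \<Otimes>\<^sub>M S) (\<lambda>\<omega>. (U \<omega>, Z j \<omega>))) f"
    using f by (subst integral_distr) auto
  also have "\<dots> = (\<integral>u. \<integral>z. f (u, z) \<partial>P \<partial>distr M N' U)"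
    unfolding distr_past_sample[OF I j U] by (rule UP.integral_fst'[OF int', symmetric])
  finally show ?thesis by (simp add: zero)
qed

end

section \<open>Noise of a minibatch\<close>

text \<open>The variance bound is stated with a nonnegative integral, so that it includes square integrability of the
deviation \<open>F x z - T x\<close>. The quadratic growth in \<open>x\<close> is what a bound of the form
\<open>\<sigma> q + \<sigma>\<^sub>0 \<parallel>x - q\<parallel>\<close> on the standard deviation gives for one fixed \<open>q\<close>.\<close>
locale stochastic_oracle = independent_samples M N X0 S P J Z
  for M :: "'w measure" and N :: "'b measure" and X0 and S :: "'z measure" and P :: "'z measure"
    and J :: "'j set" and Z :: "'j \<Rightarrow> 'w \<Rightarrow> 'z" +
  fixes F :: "real^'d \<Rightarrow> 'z \<Rightarrow> real^'d" and T :: "real^'d \<Rightarrow> real^'d" and L C :: real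
  assumes F_meas: "(\<lambda>(x, z). F x z) \<in> borel_measurable (borel \<Otimes>\<^sub>M S)"
    and F_int: "\<And>x. integrable P (F x)"
    and F_mean: "\<And>x. (\<integral>z. F x z \<partial>P) = T x"
    and F_var: "\<And>x. (\<integral>\<^sup>+z. ennreal ((norm (F x z - T x))\<^sup>2) \<partial>P) \<le> ennreal (C * (1 + (norm x)\<^sup>2))"
    and C0: "0 \<le> C"
    and T_lip: "L-lipschitz_on UNIV T"
begin

definition noise :: "('w \<Rightarrow> real^'d) \<Rightarrow> 'j \<Rightarrow> 'w \<Rightarrow> real^'d" where
  "noise X j \<omega> = F (X \<omega>) (Z j \<omega>) - T (X \<omega>)"

lemma T_cont: "continuous_on UNIV T"
  using T_lip by (rule lipschitz_on_continuous_on)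

lemma T_meas [measurable]: "T \<in> borel_measurable borel"
  using T_cont by (rule borel_measurable_continuous_onI)

lemma deviation_meas: "(\<lambda>p. F (fst p) (snd p) - T (fst p)) \<in> borel_measurable (borel \<Otimes>\<^sub>M S)"
proof -
  have [measurable]: "(\<lambda>p. F (fst p) (snd p)) \<in> borel_measurable (borel \<Otimes>\<^sub>M S)"
    using F_meas by (simp add: case_prod_beta')
  show ?thesis by measurable
qed

lemma noise_measurable_past:
  assumes X: "X \<in> borel_measurable (past I)" and I: "I \<subseteq> J" and j: "j \<in> I"
  shows "noise X j \<in> borel_measurable (past I)"
proof -
  have "(\<lambda>\<omega>. (X \<omega>, Z j \<omega>)) \<in> past I \<rightarrow>\<^sub>M borel \<Otimes>\<^sub>M S"
    using X Z_measurable_past[OF j I] by simp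
  from measurable_compose[OF this deviation_meas] show ?thesis
    unfolding noise_def[abs_def] by simp
qed

lemma from_past: "I \<subseteq> J \<Longrightarrow> f \<in> past I \<rightarrow>\<^sub>M N' \<Longrightarrow> f \<in> M \<rightarrow>\<^sub>M N'"
  using measurable_from_subalg[OF subalgebra_past] by blast

lemma nn_noise_sq_le:
  assumes X: "X \<in> borel_measurable (past I)" and I: "I \<subseteq> J" and j: "j \<in> J - I"
    and h: "h \<in> borel_measurable (past I)" "\<And>\<omega>. 0 \<le> h \<omega>"
  shows "(\<integral>\<^sup>+\<omega>. ennreal (h \<omega> * (norm (noise X j \<omega>))\<^sup>2) \<partial>M) \<le> (\<integral>\<^sup>+\<omega>. ennreal (C * (h \<omega> * (1 + (norm (X \<omega>))\<^sup>2))) \<partial>M)"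
proof -
  let ?U = "\<lambda>\<omega>. (h \<omega>, X \<omega>)"
  let ?f = "\<lambda>((a, x), z). ennreal (\<bar>a\<bar> * (norm (F x z - T x))\<^sup>2)"
  have U: "?U \<in> past I \<rightarrow>\<^sub>M borel \<Otimes>\<^sub>M borel" using X h by simp
  have [measurable]: "(\<lambda>p. F (fst p) (snd p) - T (fst p)) \<in> borel_measurable (borel \<Otimes>\<^sub>M S)"
    by (rule deviation_meas)
  have "(\<lambda>q. (snd (fst q), snd q)) \<in> ((borel :: real measure) \<Otimes>\<^sub>M (borel :: (real^'d) measure)) \<Otimes>\<^sub>M S \<rightarrow>\<^sub>M borel \<Otimes>\<^sub>M S"
    by measurable
  from measurable_compose[OF this deviation_meas]
  have [measurable]: "(\<lambda>q. F (snd (fst q)) (snd q) - T (snd (fst q)))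
    \<in> borel_measurable (((borel :: real measure) \<Otimes>\<^sub>M (borel :: (real^'d) measure)) \<Otimes>\<^sub>M S)" by simp
  have f: "?f \<in> borel_measurable ((borel \<Otimes>\<^sub>M borel) \<Otimes>\<^sub>M S)"
    unfolding case_prod_beta' by measurable
  have FP: "F x \<in> borel_measurable P" for x using F_int by auto
  have "(\<integral>\<^sup>+\<omega>. ennreal (h \<omega> * (norm (noise X j \<omega>))\<^sup>2) \<partial>M) = (\<integral>\<^sup>+\<omega>. ?f (?U \<omega>, Z j \<omega>) \<partial>M)"
    using h(2) by (simp add: noise_def)
  also have "\<dots> = (\<integral>\<^sup>+\<omega>. \<integral>\<^sup>+z. ?f (?U \<omega>, z) \<partial>P \<partial>M)"
    by (rule nn_integral_past_sample[OF I j U f])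
  also have "\<dots> \<le> (\<integral>\<^sup>+\<omega>. ennreal (C * (h \<omega> * (1 + (norm (X \<omega>))\<^sup>2))) \<partial>M)"
  proof (rule nn_integral_mono)
    fix \<omega>
    have "(\<integral>\<^sup>+z. ?f (?U \<omega>, z) \<partial>P) = ennreal (h \<omega>) * (\<integral>\<^sup>+z. ennreal ((norm (F (X \<omega>) z - T (X \<omega>)))\<^sup>2) \<partial>P)"
      using h(2)[of \<omega>] FP by (simp add: ennreal_mult nn_integral_cmult)
    also have "\<dots> \<le> ennreal (h \<omega>) * ennreal (C * (1 + (norm (X \<omega>))\<^sup>2))"
      by (intro mult_left_mono F_var) auto
    also have "\<dots> = ennreal (C * (h \<omega> * (1 + (norm (X \<omega>))\<^sup>2)))"
      using h(2)[of \<omega>] C0 by (simp flip: ennreal_mult add: algebra_simps)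
    finally show "(\<integral>\<^sup>+z. ?f (?U \<omega>, z) \<partial>P) \<le> ennreal (C * (h \<omega> * (1 + (norm (X \<omega>))\<^sup>2)))" .
  qed
  finally show ?thesis .
qed

lemma noise_square_integrable:
  assumes X: "X \<in> borel_measurable (past I)" "square_integrable M X" and I: "I \<subseteq> J" and j: "j \<in> J - I"
  shows "square_integrable M (noise X j)"
proof -
  have "X \<in> borel_measurable (past (insert j I))" using X(1) by (rule measurable_past_mono[rotated]) auto
  then have "noise X j \<in> borel_measurable (past (insert j I))"
    using I j by (intro noise_measurable_past) auto
  then have n: "noise X j \<in> borel_measurable M" using I j by (intro from_past[of "insert j I"]) auto
  have "(\<integral>\<^sup>+\<omega>. ennreal ((norm (noise X j \<omega>))\<^sup>2) \<partial>M) \<le> (\<integral>\<^sup>+\<omega>. ennreal (C * (1 + (norm (X \<omega>))\<^sup>2)) \<partial>M)"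
    using nn_noise_sq_le[OF X(1) I j, of "\<lambda>_. 1"] by simp
  also have "\<dots> < \<infinity>"
  proof -
    have "integrable M (\<lambda>\<omega>. C * (1 + (norm (X \<omega>))\<^sup>2))" using X(2) by (auto simp: square_integrable_def)
    then show ?thesis using C0 unfolding integrable_iff_bounded by auto
  qed
  finally have "integrable M (\<lambda>\<omega>. (norm (noise X j \<omega>))\<^sup>2)"
    using n by (intro integrableI_bounded) auto
  then show ?thesis using n by (simp add: square_integrable_def)
qed

lemma expectation_noise_sq_le:
  assumes X: "X \<in> borel_measurable (past I)" "square_integrable M X" and I: "I \<subseteq> J" and j: "j \<in> J - I"
    and h: "h \<in> borel_measurable (past I)" "\<And>\<omega>. 0 \<le> h \<omega>" "\<And>\<omega>. h \<omega> \<le> 1"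
  shows "(\<integral>\<omega>. h \<omega> * (norm (noise X j \<omega>))\<^sup>2 \<partial>M) \<le> C * (\<integral>\<omega>. h \<omega> * (1 + (norm (X \<omega>))\<^sup>2) \<partial>M)"
proof -
  have hM: "h \<in> borel_measurable M" "\<bar>h \<omega>\<bar> \<le> 1" for \<omega> using h from_past[OF I] by auto
  have i1: "integrable M (\<lambda>\<omega>. h \<omega> * (norm (noise X j \<omega>))\<^sup>2)"
    using noise_square_integrable[OF X I j] hM by (intro integrable_weighted) (auto simp: square_integrable_def)
  have i2: "integrable M (\<lambda>\<omega>. C * (h \<omega> * (1 + (norm (X \<omega>))\<^sup>2)))"
    using X(2) hM by (intro integrable_mult_right integrable_weighted) (auto simp: square_integrable_def)
  have "ennreal (\<integral>\<omega>. h \<omega> * (norm (noise X j \<omega>))\<^sup>2 \<partial>M) \<le> ennreal (\<integral>\<omega>. C * (h \<omega> * (1 + (norm (X \<omega>))\<^sup>2)) \<partial>M)"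
    using nn_noise_sq_le[OF X(1) I j h(1,2)] i1 i2 h(2) C0
    by (subst (asm) (1 2) nn_integral_eq_integral) auto
  then have "(\<integral>\<omega>. h \<omega> * (norm (noise X j \<omega>))\<^sup>2 \<partial>M) \<le> (\<integral>\<omega>. C * (h \<omega> * (1 + (norm (X \<omega>))\<^sup>2)) \<partial>M)"
    using h(2) C0 by (subst (asm) ennreal_le_iff) (auto intro!: integral_nonneg)
  then show ?thesis by simp
qed

text \<open>Unbiasedness given the past: the fresh sample \<open>Z j\<close> is integrated out first, with the point \<open>X\<close> and the test vector \<open>H\<close>
held fixed. The past \<open>I'\<close> of \<open>H\<close> may be larger than that of \<open>X\<close>; this allows \<open>H\<close> to contain the noise of
other samples of the same batch.\<close>
lemma expectation_noise_orthogonal: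
  assumes X: "X \<in> borel_measurable (past I)" "square_integrable M X" and I: "I \<subseteq> I'" "I' \<subseteq> J" and j: "j \<in> J - I'"
    and H: "H \<in> borel_measurable (past I')" "square_integrable M H"
  shows "(\<integral>\<omega>. inner (H \<omega>) (noise X j \<omega>) \<partial>M) = 0"
proof -
  let ?f = "\<lambda>(u, z). inner (fst u) (F (snd u) z - T (snd u))"
  let ?U = "\<lambda>\<omega>. (H \<omega>, X \<omega>)"
  have X': "X \<in> borel_measurable (past I')" using X(1) I(1) by (rule measurable_past_mono[rotated])
  have U: "?U \<in> past I' \<rightarrow>\<^sub>M borel \<Otimes>\<^sub>M borel" using X' H by simp
  have "(\<lambda>q. (snd (fst q), snd q)) \<in> ((borel :: (real^'d) measure) \<Otimes>\<^sub>M (borel :: (real^'d) measure)) \<Otimes>\<^sub>M S \<rightarrow>\<^sub>M borel \<Otimes>\<^sub>M S"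
    by measurable
  from measurable_compose[OF this deviation_meas]
  have [measurable]: "(\<lambda>q. F (snd (fst q)) (snd q) - T (snd (fst q)))
    \<in> borel_measurable (((borel :: (real^'d) measure) \<Otimes>\<^sub>M (borel :: (real^'d) measure)) \<Otimes>\<^sub>M S)" by simp
  have f: "?f \<in> borel_measurable ((borel \<Otimes>\<^sub>M borel) \<Otimes>\<^sub>M S)"
    unfolding case_prod_beta' by measurable
  interpret P: prob_space P using prob_space_P[of j] j by simp
  have zero: "(\<integral>z. ?f (u, z) \<partial>P) = 0" for u
    using F_int F_mean[of "snd u"] by (simp add: P.prob_space)
  have "integrable M (\<lambda>\<omega>. ?f (?U \<omega>, Z j \<omega>))"
    using integrable_inner[OF H(2) noise_square_integrable[OF X' X(2) I(2) j]] by (simp add: noise_def)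
  from integral_past_sample_eq_0[OF I(2) j U f this zero] show ?thesis by (simp add: noise_def)
qed

lemma noise_sum_measurable_past:
  assumes X: "X \<in> borel_measurable (past I)" and I: "I \<subseteq> J" and B: "B \<subseteq> J"
  shows "(\<lambda>\<omega>. \<Sum>j\<in>B. noise X j \<omega>) \<in> borel_measurable (past (I \<union> B))"
proof (rule borel_measurable_sum)
  fix j assume "j \<in> B"
  then show "noise X j \<in> borel_measurable (past (I \<union> B))"
    using I B measurable_past_mono[OF _ X, of "I \<union> B"] by (intro noise_measurable_past) auto
qed

lemma noise_sum_square_integrable:
  assumes X: "X \<in> borel_measurable (past I)" "square_integrable M X" and I: "I \<subseteq> J" and B: "B \<subseteq> J - I"
  shows "square_integrable M (\<lambda>\<omega>. \<Sum>j\<in>B. noise X j \<omega>)"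
  using B by (intro square_integrable_sum noise_square_integrable[OF X I]) (auto simp: finite_measure_axioms)

text \<open>Pythagoras: the noise of a new sample is orthogonal to the sum over the earlier ones, so variances add and the
second moment of the sum grows linearly, not quadratically, in the batch size.\<close>
lemma expectation_noise_sum_sq_le:
  assumes X: "X \<in> borel_measurable (past I)" "square_integrable M X" and I: "I \<subseteq> J" and B: "B \<subseteq> J - I" "finite B"
    and h: "h \<in> borel_measurable (past I)" "\<And>\<omega>. 0 \<le> h \<omega>" "\<And>\<omega>. h \<omega> \<le> 1"
  shows "(\<integral>\<omega>. h \<omega> * (norm (\<Sum>j\<in>B. noise X j \<omega>))\<^sup>2 \<partial>M)
    \<le> real (card B) * C * (\<integral>\<omega>. h \<omega> * (1 + (norm (X \<omega>))\<^sup>2) \<partial>M)"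
  using B(2,1)
proof (induction B)
  case empty
  then show ?case by simp
next
  case (insert j B)
  let ?s = "\<lambda>\<omega>. \<Sum>j\<in>B. noise X j \<omega>"
  have hM: "h \<in> borel_measurable M" "\<bar>h \<omega>\<bar> \<le> 1" for \<omega> using h from_past[OF I] by auto
  have j: "j \<in> J - I" "j \<in> J - (I \<union> B)" and BJ: "B \<subseteq> J - I" "I \<union> B \<subseteq> J" using insert I by auto
  have sm: "?s \<in> borel_measurable (past (I \<union> B))" using BJ I by (intro noise_sum_measurable_past X) auto
  have ss: "square_integrable M ?s" by (rule noise_sum_square_integrable[OF X I BJ(1)])
  have sn: "square_integrable M (noise X j)" by (rule noise_square_integrable[OF X I j(1)])
  have hI: "h \<in> borel_measurable (past (I \<union> B))" using h(1) by (rule measurable_past_mono[rotated]) auto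
  have hs: "(\<lambda>\<omega>. h \<omega> *\<^sub>R ?s \<omega>) \<in> borel_measurable (past (I \<union> B))" using hI sm by simp
  have hs2: "square_integrable M (\<lambda>\<omega>. h \<omega> *\<^sub>R ?s \<omega>)" by (rule square_integrable_weighted[OF ss hM])
  have orth: "(\<integral>\<omega>. inner (h \<omega> *\<^sub>R ?s \<omega>) (noise X j \<omega>) \<partial>M) = 0"
    by (rule expectation_noise_orthogonal[OF X Un_upper1 BJ(2) j(2) hs hs2])
  have int: "integrable M (\<lambda>\<omega>. h \<omega> * (norm (?s \<omega>))\<^sup>2)" "integrable M (\<lambda>\<omega>. h \<omega> * (norm (noise X j \<omega>))\<^sup>2)"
    "integrable M (\<lambda>\<omega>. inner (h \<omega> *\<^sub>R ?s \<omega>) (noise X j \<omega>))"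
    using ss sn by (auto intro!: integrable_weighted hM integrable_inner hs2 simp: square_integrable_def)
  have "(\<integral>\<omega>. h \<omega> * (norm (\<Sum>j\<in>insert j B. noise X j \<omega>))\<^sup>2 \<partial>M)
    = (\<integral>\<omega>. h \<omega> * (norm (?s \<omega>))\<^sup>2 + 2 * inner (h \<omega> *\<^sub>R ?s \<omega>) (noise X j \<omega>) + h \<omega> * (norm (noise X j \<omega>))\<^sup>2 \<partial>M)"
  proof (rule Bochner_Integration.integral_cong[OF refl])
    fix \<omega>
    have "(norm (noise X j \<omega> + ?s \<omega>))\<^sup>2 = (norm (?s \<omega>))\<^sup>2 + 2 * inner (?s \<omega>) (noise X j \<omega>) + (norm (noise X j \<omega>))\<^sup>2"
      by (simp add: power2_norm_eq_inner inner_add_left inner_add_right inner_commute)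
    then show "h \<omega> * (norm (\<Sum>j\<in>insert j B. noise X j \<omega>))\<^sup>2
      = h \<omega> * (norm (?s \<omega>))\<^sup>2 + 2 * inner (h \<omega> *\<^sub>R ?s \<omega>) (noise X j \<omega>) + h \<omega> * (norm (noise X j \<omega>))\<^sup>2"
      using insert by (simp add: algebra_simps)
  qed
  also have "\<dots> = (\<integral>\<omega>. h \<omega> * (norm (?s \<omega>))\<^sup>2 \<partial>M) + (\<integral>\<omega>. h \<omega> * (norm (noise X j \<omega>))\<^sup>2 \<partial>M)"
    using int orth by (simp del: inner_scaleR_left)
  also have "\<dots> \<le> real (card B) * C * (\<integral>\<omega>. h \<omega> * (1 + (norm (X \<omega>))\<^sup>2) \<partial>M) + C * (\<integral>\<omega>. h \<omega> * (1 + (norm (X \<omega>))\<^sup>2) \<partial>M)"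
    using insert.IH[OF BJ(1)] expectation_noise_sq_le[OF X I j(1) h] by (rule add_mono)
  finally show ?case using insert by (simp add: algebra_simps)
qed

definition batch_noise :: "('w \<Rightarrow> real^'d) \<Rightarrow> 'j set \<Rightarrow> 'w \<Rightarrow> real^'d" where
  "batch_noise X B \<omega> = (1 / real (card B)) *\<^sub>R (\<Sum>j\<in>B. noise X j \<omega>)"

lemma batch_mean_eq:
  assumes "finite B" "B \<noteq> {}"
  shows "(1 / real (card B)) *\<^sub>R (\<Sum>j\<in>B. F (X \<omega>) (Z j \<omega>)) = T (X \<omega>) + batch_noise X B \<omega>"
  using assms by (simp add: batch_noise_def noise_def sum_subtractf scaleR_diff_right sum_constant_scaleR del: sum_constant)

lemma batch_noise_measurable_past:
  assumes "X \<in> borel_measurable (past I)" "I \<subseteq> J" "B \<subseteq> J"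
  shows "batch_noise X B \<in> borel_measurable (past (I \<union> B))"
  unfolding batch_noise_def[abs_def] using noise_sum_measurable_past[OF assms] by simp

lemma batch_noise_square_integrable:
  assumes "X \<in> borel_measurable (past I)" "square_integrable M X" "I \<subseteq> J" "B \<subseteq> J - I"
  shows "square_integrable M (batch_noise X B)"
  unfolding batch_noise_def[abs_def] by (intro square_integrable_scale noise_sum_square_integrable[OF assms])

lemma expectation_batch_noise_sq_le:
  assumes X: "X \<in> borel_measurable (past I)" "square_integrable M X" and I: "I \<subseteq> J"
    and B: "B \<subseteq> J - I" "finite B"
    and h: "h \<in> borel_measurable (past I)" "\<And>\<omega>. 0 \<le> h \<omega>" "\<And>\<omega>. h \<omega> \<le> 1"
  shows "(\<integral>\<omega>. h \<omega> * (norm (batch_noise X B \<omega>))\<^sup>2 \<partial>M)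
    \<le> C / real (card B) * (\<integral>\<omega>. h \<omega> * (1 + (norm (X \<omega>))\<^sup>2) \<partial>M)"
proof (cases "B = {}")
  case True
  then show ?thesis by (simp add: batch_noise_def)
next
  case False
  then have k: "real (card B) > 0" using B by (simp add: card_gt_0_iff)
  have "(\<integral>\<omega>. h \<omega> * (norm (batch_noise X B \<omega>))\<^sup>2 \<partial>M)
     = (1 / real (card B))\<^sup>2 * (\<integral>\<omega>. h \<omega> * (norm (\<Sum>j\<in>B. noise X j \<omega>))\<^sup>2 \<partial>M)"
    unfolding batch_noise_def norm_scaleR power_mult_distrib
    by (subst integral_mult_right_zero[symmetric]) (simp add: mult_ac)
  also have "\<dots> \<le> (1 / real (card B))\<^sup>2 * (real (card B) * C * (\<integral>\<omega>. h \<omega> * (1 + (norm (X \<omega>))\<^sup>2) \<partial>M))"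
    by (intro mult_left_mono expectation_noise_sum_sq_le[OF X I B h]) auto
  also have "\<dots> = C / real (card B) * (\<integral>\<omega>. h \<omega> * (1 + (norm (X \<omega>))\<^sup>2) \<partial>M)"
    using k by (simp add: power2_eq_square field_simps)
  finally show ?thesis .
qed

lemma expectation_batch_noise_orthogonal:
  assumes X: "X \<in> borel_measurable (past I)" "square_integrable M X" and I: "I \<subseteq> J"
    and B: "B \<subseteq> J - I"
    and H: "H \<in> borel_measurable (past I)" "square_integrable M H"
  shows "(\<integral>\<omega>. inner (H \<omega>) (batch_noise X B \<omega>) \<partial>M) = 0"
proof -
  have "(\<integral>\<omega>. inner (H \<omega>) (batch_noise X B \<omega>) \<partial>M) = (\<integral>\<omega>. (1 / real (card B)) * (\<Sum>j\<in>B. inner (H \<omega>) (noise X j \<omega>)) \<partial>M)"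
    by (simp add: batch_noise_def inner_sum_right)
  also have "\<dots> = (1 / real (card B)) * (\<Sum>j\<in>B. (\<integral>\<omega>. inner (H \<omega>) (noise X j \<omega>) \<partial>M))"
    using B by (subst integral_mult_right_zero, subst Bochner_Integration.integral_sum)
      (auto intro!: integrable_inner H noise_square_integrable[OF X I])
  also have "\<dots> = 0"
    using B expectation_noise_orthogonal[OF X order_refl I _ H] by (auto intro!: sum.neutral)
  finally show ?thesis .
qed

end

section \<open>The stochastic process\<close>

definition forward_backward ::
  "(real^'d) set \<Rightarrow> (real^'d \<Rightarrow> 'z \<Rightarrow> real^'d) \<Rightarrow> real \<Rightarrow> nat \<Rightarrow> (nat \<Rightarrow> 'z) \<Rightarrow> real^'d \<Rightarrow> real^'d" where
  "forward_backward K F a k u x = closest_point K (x - a *\<^sub>R minibatch F k u x)"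

text \<open>The iterate as a function of the starting point and of the sample values. Processes with different
starting points, or with \<open>F\<close> altered on a null set, are compared through this function on a common sample path.\<close>
primrec sfbf_path ::
  "(real^'d) set \<Rightarrow> (real^'d \<Rightarrow> 'z \<Rightarrow> real^'d) \<Rightarrow> (nat \<Rightarrow> real) \<Rightarrow> (nat \<Rightarrow> nat) \<Rightarrow> real^'d \<Rightarrow>
    (nat \<Rightarrow> nat \<Rightarrow> 'z) \<Rightarrow> (nat \<Rightarrow> nat \<Rightarrow> 'z) \<Rightarrow> nat \<Rightarrow> real^'d" where
  "sfbf_path K F \<alpha> m x u v 0 = x"
| "sfbf_path K F \<alpha> m x u v (Suc n) =
    (let a = sfbf_path K F \<alpha> m x u v n; y = forward_backward K F (\<alpha> n) (m (Suc n)) (u (Suc n)) a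
     in y + \<alpha> n *\<^sub>R (minibatch F (m (Suc n)) (u (Suc n)) a - minibatch F (m (Suc n)) (v (Suc n)) y))"

locale sfbf = stochastic_oracle M borel X0 S P "sample_indices m" "samples xs es" F T L C
  for M :: "'w measure" and X0 :: "'w \<Rightarrow> real^'d" and S :: "'z measure" and P :: "'z measure"
    and m :: "nat \<Rightarrow> nat" and xs es :: "nat \<Rightarrow> nat \<Rightarrow> 'w \<Rightarrow> 'z"
    and F :: "real^'d \<Rightarrow> 'z \<Rightarrow> real^'d" and T :: "real^'d \<Rightarrow> real^'d" and L C :: real +
  fixes K :: "(real^'d) set" and \<alpha> :: "nat \<Rightarrow> real" and lo hi :: real
  assumes K: "convex K" "closed K"
    and mono: "pseudo_monotone T"
    and sol: "vi_solutions K T \<noteq> {}"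
    and lo: "0 < lo" and alpha: "\<And>n. lo \<le> \<alpha> n" "\<And>n. \<alpha> n \<le> hi"
    and hi: "2 * hi\<^sup>2 * L\<^sup>2 < 1"
    and m_pos: "\<And>n. 1 \<le> n \<Longrightarrow> 1 \<le> m n"
    and m_sum: "summable (\<lambda>n. 1 / real (m (Suc n)))"
begin

definition X :: "nat \<Rightarrow> 'w \<Rightarrow> real^'d" where
  "X n \<omega> = sfbf_path K F \<alpha> m (X0 \<omega>) (\<lambda>k i. xs k i \<omega>) (\<lambda>k i. es k i \<omega>) n"

definition Y :: "nat \<Rightarrow> 'w \<Rightarrow> real^'d" where
  "Y n \<omega> = forward_backward K F (\<alpha> n) (m (Suc n)) (\<lambda>i. xs (Suc n) i \<omega>) (X n \<omega>)"

text \<open>The starting point and the samples drawn up to stage \<open>n\<close> determine \<open>X n\<close>; adding the first minibatch of the next stage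
(\<open>seen_half n\<close>) determines \<open>Y n\<close>. The second minibatch is independent of both.\<close>
definition seen :: "nat \<Rightarrow> (nat \<times> nat + nat \<times> nat) set" where
  "seen n = {j \<in> sample_indices m. case_sum fst fst j \<le> n}"

definition forward_batch :: "nat \<Rightarrow> (nat \<times> nat + nat \<times> nat) set" where
  "forward_batch n = (\<lambda>i. Inl (Suc n, i)) ` {1..m (Suc n)}"

definition backward_batch :: "nat \<Rightarrow> (nat \<times> nat + nat \<times> nat) set" where
  "backward_batch n = (\<lambda>i. Inr (Suc n, i)) ` {1..m (Suc n)}"

definition seen_half :: "nat \<Rightarrow> (nat \<times> nat + nat \<times> nat) set" where
  "seen_half n = seen n \<union> forward_batch n"

definition W :: "nat \<Rightarrow> 'w \<Rightarrow> real^'d" where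
  "W n = batch_noise (X n) (forward_batch n)"

definition V :: "nat \<Rightarrow> 'w \<Rightarrow> real^'d" where
  "V n = batch_noise (Y n) (backward_batch n)"

lemma seen_subset: "seen n \<subseteq> sample_indices m"
  by (auto simp: seen_def)

lemma forward_batch_new: "forward_batch n \<subseteq> sample_indices m - seen n"
  by (auto simp: forward_batch_def seen_def sample_indices_def batch_indices_def)

lemma backward_batch_new: "backward_batch n \<subseteq> sample_indices m - seen_half n"
  by (auto simp: backward_batch_def forward_batch_def seen_half_def seen_def sample_indices_def batch_indices_def)

lemma seen_half_subset: "seen_half n \<subseteq> sample_indices m"
  using forward_batch_new seen_subset by (auto simp: seen_half_def)

lemma seen_subset_half: "seen n \<subseteq> seen_half n"
  by (simp add: seen_half_def)

lemma seen_half_Suc: "seen_half n \<union> backward_batch n \<subseteq> seen (Suc n)"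
  by (auto simp: backward_batch_def forward_batch_def seen_half_def seen_def sample_indices_def batch_indices_def)

lemma seen_Suc: "seen n \<subseteq> seen (Suc n)"
  by (auto simp: seen_def)

lemma batch_card: "card (forward_batch n) = m (Suc n)" "card (backward_batch n) = m (Suc n)"
  unfolding forward_batch_def backward_batch_def by (subst card_image; simp add: inj_on_def)+

lemma batch_finite: "finite (forward_batch n)" "finite (backward_batch n)"
  "forward_batch n \<noteq> {}" "backward_batch n \<noteq> {}"
  using m_pos[of "Suc n"] by (auto simp: forward_batch_def backward_batch_def)

lemma minibatch_forward:
  "minibatch F (m (Suc n)) (\<lambda>i. xs (Suc n) i \<omega>) (X n \<omega>) = T (X n \<omega>) + W n \<omega>"
  unfolding W_def batch_mean_eq[OF batch_finite(1,3), symmetric] batch_card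
  by (simp add: minibatch_def forward_batch_def sum.reindex inj_on_def samples_def)

lemma minibatch_backward:
  "minibatch F (m (Suc n)) (\<lambda>i. es (Suc n) i \<omega>) (Y n \<omega>) = T (Y n \<omega>) + V n \<omega>"
  unfolding V_def batch_mean_eq[OF batch_finite(2,4), symmetric] batch_card
  by (simp add: minibatch_def backward_batch_def sum.reindex inj_on_def samples_def)

lemma X_0: "X 0 \<omega> = X0 \<omega>"
  by (simp add: X_def)

lemma Y_eq: "Y n \<omega> = closest_point K (X n \<omega> - \<alpha> n *\<^sub>R (T (X n \<omega>) + W n \<omega>))"
  unfolding Y_def forward_backward_def minibatch_forward ..

lemma X_Suc: "X (Suc n) \<omega> = Y n \<omega> + \<alpha> n *\<^sub>R ((T (X n \<omega>) + W n \<omega>) - (T (Y n \<omega>) + V n \<omega>))"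
  unfolding minibatch_forward[symmetric] minibatch_backward[symmetric]
  by (simp add: X_def Y_def Let_def)

lemma K_nonempty: "K \<noteq> {}"
  using sol vi_solutions_subset by blast

lemma solutions_closed_convex: "closed (vi_solutions K T)" "convex (vi_solutions K T)"
  by (rule vi_solutions_closed_convex[OF K T_cont mono])+

lemma alpha_pos: "0 < \<alpha> n"
  using alpha(1)[of n] lo by linarith

lemma hi_L: "hi * L \<le> 1"
proof -
  have "(hi * L)\<^sup>2 \<le> 1\<^sup>2" using hi by (simp add: power_mult_distrib)
  then show ?thesis by (rule power2_le_imp_le) simp
qed

lemma projection_meas: "convex E \<Longrightarrow> closed E \<Longrightarrow> E \<noteq> {} \<Longrightarrow> closest_point E \<in> borel_measurable borel"
  for E :: "(real^'d) set"
  by (intro borel_measurable_continuous_onI continuous_on_closest_point)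

lemma
  X_adapted: "X n \<in> borel_measurable (past (seen n))"
  and Y_adapted: "Y n \<in> borel_measurable (past (seen_half n))"
proof -
  have Y: "Y n \<in> borel_measurable (past (seen_half n))" if X: "X n \<in> borel_measurable (past (seen n))" for n
  proof -
    have [measurable]: "W n \<in> borel_measurable (past (seen_half n))"
      unfolding W_def seen_half_def using forward_batch_new[of n]
      by (intro batch_noise_measurable_past X seen_subset) auto
    have [measurable]: "X n \<in> borel_measurable (past (seen_half n))"
      using X by (rule measurable_past_mono[OF seen_subset_half])
    have [measurable]: "closest_point K \<in> borel_measurable borel"
      using K K_nonempty by (rule projection_meas)
    show ?thesis unfolding Y_eq[abs_def] by measurable
  qed
  show X: "X n \<in> borel_measurable (past (seen n))" for n
  proof (induction n)
    case 0
    show ?case unfolding X_0[abs_def] by (rule X0_measurable_past)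
  next
    case (Suc n)
    have W: "W n \<in> borel_measurable (past (seen_half n))"
      unfolding W_def seen_half_def using forward_batch_new[of n]
      by (intro batch_noise_measurable_past Suc seen_subset) auto
    have V: "V n \<in> borel_measurable (past (seen_half n \<union> backward_batch n))"
      unfolding V_def using backward_batch_new[of n]
      by (intro batch_noise_measurable_past Y Suc seen_half_subset) auto
    have half: "seen_half n \<subseteq> seen (Suc n)" using seen_half_Suc by blast
    have [measurable]: "V n \<in> borel_measurable (past (seen (Suc n)))"
      using V by (rule measurable_past_mono[OF seen_half_Suc])
    have [measurable]: "W n \<in> borel_measurable (past (seen (Suc n)))" "Y n \<in> borel_measurable (past (seen (Suc n)))"
      using W Y[OF Suc] by (auto intro: measurable_past_mono[OF half])
    have [measurable]: "X n \<in> borel_measurable (past (seen (Suc n)))"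
      using Suc by (rule measurable_past_mono[OF seen_Suc])
    show ?case unfolding X_Suc[abs_def] by measurable
  qed
  show "Y n \<in> borel_measurable (past (seen_half n))" using Y X .
qed

lemma X_meas [measurable]: "X n \<in> borel_measurable M"
  using from_past[OF seen_subset X_adapted] .

lemma Y_meas [measurable]: "Y n \<in> borel_measurable M"
  using from_past[OF seen_half_subset Y_adapted] .

text \<open>The constant collects the two noise variances in \<open>expected_step\<close>, each estimated in terms of
\<open>1 + \<parallel>q\<parallel>\<^sup>2 + \<parallel>X n - q\<parallel>\<^sup>2\<close>: the first minibatch contributes \<open>2\<close>, the second \<open>16 + 8 * hi\<^sup>2 * C\<close>, and
the noise enters the step inequality with the factor \<open>4 * hi\<^sup>2\<close>.\<close>
definition growth_const :: real where
  "growth_const = 4 * hi\<^sup>2 * C * (18 + 8 * hi\<^sup>2 * C)"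

definition \<gamma> :: "nat \<Rightarrow> real" where
  "\<gamma> n = growth_const / real (m (Suc n))"

lemma gamma_nonneg: "0 \<le> \<gamma> n"
  using C0 by (simp add: \<gamma>_def growth_const_def)

lemma gamma_summable: "summable \<gamma>"
  unfolding \<gamma>_def[abs_def] using summable_mult[OF m_sum, of growth_const] by simp

end

locale sfbf_square_integrable = sfbf M X0 S P m xs es F T L C K \<alpha> lo hi
  for M :: "'w measure" and X0 :: "'w \<Rightarrow> real^'d" and S :: "'z measure" and P :: "'z measure"
    and m :: "nat \<Rightarrow> nat" and xs es :: "nat \<Rightarrow> nat \<Rightarrow> 'w \<Rightarrow> 'z"
    and F :: "real^'d \<Rightarrow> 'z \<Rightarrow> real^'d" and T :: "real^'d \<Rightarrow> real^'d" and L C :: real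
    and K :: "(real^'d) set" and \<alpha> :: "nat \<Rightarrow> real" and lo hi :: real +
  assumes X0_sq: "square_integrable M X0"
begin

lemma W_square_integrable_if: "square_integrable M (X n) \<Longrightarrow> square_integrable M (W n)"
  unfolding W_def by (rule batch_noise_square_integrable[OF X_adapted _ seen_subset forward_batch_new])

lemma V_square_integrable_if: "square_integrable M (Y n) \<Longrightarrow> square_integrable M (V n)"
  unfolding V_def by (rule batch_noise_square_integrable[OF Y_adapted _ seen_half_subset backward_batch_new])

lemma Y_square_integrable_if:
  assumes X: "square_integrable M (X n)"
  shows "square_integrable M (Y n)"
proof -
  obtain q where q: "q \<in> vi_solutions K T" using sol by blast
  have qi: "square_integrable M (\<lambda>\<omega>. X n \<omega> - q)"
    using X by (intro square_integrable_diff) (auto simp: finite_measure_axioms)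
  show ?thesis
  proof (rule square_integrable_bound)
    show "integrable M (\<lambda>\<omega>. 2 * (norm q)\<^sup>2 + 16 * (norm (X n \<omega> - q))\<^sup>2 + 4 * hi\<^sup>2 * (norm (W n \<omega>))\<^sup>2)"
      using qi W_square_integrable_if[OF X] by (auto simp: square_integrable_def)
    show "(norm (Y n \<omega>))\<^sup>2 \<le> 2 * (norm q)\<^sup>2 + 16 * (norm (X n \<omega> - q))\<^sup>2 + 4 * hi\<^sup>2 * (norm (W n \<omega>))\<^sup>2" for \<omega>
      by (rule fb_point_growth[OF K T_lip q alpha_pos alpha(2) hi_L Y_eq])
  qed measurable
qed

lemma X_square_integrable: "square_integrable M (X n)"
proof (induction n)
  case 0
  show ?case unfolding X_0[abs_def] using X0_sq by simp
next
  case (Suc n)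
  note Y = Y_square_integrable_if[OF Suc]
  note WV = W_square_integrable_if[OF Suc] V_square_integrable_if[OF Y]
  have "square_integrable M (\<lambda>\<omega>. T (X n \<omega>))" "square_integrable M (\<lambda>\<omega>. T (Y n \<omega>))"
    using Suc Y by (auto intro: square_integrable_lipschitz_image[OF finite_measure_axioms _ T_lip])
  then show ?case
    unfolding X_Suc[abs_def]
    by (intro square_integrable_add square_integrable_scale square_integrable_diff Y WV)
qed

lemmas Y_square_integrable = Y_square_integrable_if[OF X_square_integrable]
lemmas W_square_integrable = W_square_integrable_if[OF X_square_integrable]
lemmas V_square_integrable = V_square_integrable_if[OF Y_square_integrable]

lemma expectation_W_sq_le:
  assumes h: "h \<in> borel_measurable (past (seen n))" "\<And>\<omega>. 0 \<le> h \<omega>" "\<And>\<omega>. h \<omega> \<le> 1"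
  shows "(\<integral>\<omega>. h \<omega> * (norm (W n \<omega>))\<^sup>2 \<partial>M) \<le> C / real (m (Suc n)) * (\<integral>\<omega>. h \<omega> * (1 + (norm (X n \<omega>))\<^sup>2) \<partial>M)"
  unfolding W_def using expectation_batch_noise_sq_le[OF X_adapted X_square_integrable seen_subset forward_batch_new batch_finite(1) h]
  by (simp add: batch_card)

lemma expectation_V_sq_le:
  assumes h: "h \<in> borel_measurable (past (seen_half n))" "\<And>\<omega>. 0 \<le> h \<omega>" "\<And>\<omega>. h \<omega> \<le> 1"
  shows "(\<integral>\<omega>. h \<omega> * (norm (V n \<omega>))\<^sup>2 \<partial>M) \<le> C / real (m (Suc n)) * (\<integral>\<omega>. h \<omega> * (1 + (norm (Y n \<omega>))\<^sup>2) \<partial>M)"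
  unfolding V_def using expectation_batch_noise_sq_le[OF Y_adapted Y_square_integrable seen_half_subset backward_batch_new batch_finite(2) h]
  by (simp add: batch_card)

text \<open>Multiply the deterministic step inequality by \<open>h\<close> and integrate. The term linear in \<open>V n\<close> vanishes, because
\<open>h (Y n - q)\<close> is known before the second minibatch is drawn; the quadratic terms are bounded through the
variances of the two minibatches.\<close>
lemma expected_step:
  assumes h: "h \<in> borel_measurable (past (seen n))" "\<And>\<omega>. 0 \<le> h \<omega>" "\<And>\<omega>. h \<omega> \<le> 1"
    and q: "q \<in> borel_measurable (past (seen n))" "square_integrable M q" "\<And>\<omega>. q \<omega> \<in> vi_solutions K T"
  shows "(\<integral>\<omega>. h \<omega> * (norm (X (Suc n) \<omega> - q \<omega>))\<^sup>2 \<partial>M) + (1 - 2 * hi\<^sup>2 * L\<^sup>2) * (\<integral>\<omega>. h \<omega> * (norm (X n \<omega> - Y n \<omega>))\<^sup>2 \<partial>M)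
    \<le> (1 + \<gamma> n) * (\<integral>\<omega>. h \<omega> * (norm (X n \<omega> - q \<omega>))\<^sup>2 \<partial>M) + \<gamma> n * (\<integral>\<omega>. h \<omega> * (1 + (norm (q \<omega>))\<^sup>2) \<partial>M)"
proof -
  define k where "k = real (m (Suc n))"
  have k: "k \<ge> 1" using m_pos[of "Suc n"] by (simp add: k_def)
  have hM: "h \<in> borel_measurable M" "\<bar>h \<omega>\<bar> \<le> 1" for \<omega> using h from_past[OF seen_subset] by auto
  have hh: "h \<in> borel_measurable (past (seen_half n))" "q \<in> borel_measurable (past (seen_half n))"
    using h(1) q(1) by (auto intro: measurable_past_mono[OF seen_subset_half])
  have int: "integrable M (\<lambda>\<omega>. h \<omega> * (norm (f \<omega>))\<^sup>2)" if "square_integrable M f" for f :: "'w \<Rightarrow> real^'d"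
    using that by (intro integrable_weighted hM) (auto simp: square_integrable_def)
  have h1: "integrable M (\<lambda>\<omega>. h \<omega>)" using integrable_weighted[of M "\<lambda>_. 1" h] hM by simp
  note sq = X_square_integrable Y_square_integrable W_square_integrable V_square_integrable q(2)
  note ints = int[OF square_integrable_diff[OF X_square_integrable q(2)], of "Suc n"]
     int[OF square_integrable_diff[OF X_square_integrable q(2)], of n]
     int[OF square_integrable_diff[OF X_square_integrable Y_square_integrable], of n n]
     int[OF W_square_integrable, of n] int[OF V_square_integrable, of n] int[OF q(2)] int[OF X_square_integrable, of n]
     int[OF Y_square_integrable, of n] h1
  let ?EV = "\<integral>\<omega>. h \<omega> * (norm (V n \<omega>))\<^sup>2 \<partial>M" and ?EW = "\<integral>\<omega>. h \<omega> * (norm (W n \<omega>))\<^sup>2 \<partial>M"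
  let ?D = "\<integral>\<omega>. h \<omega> * (norm (X n \<omega> - q \<omega>))\<^sup>2 \<partial>M" and ?R = "\<integral>\<omega>. h \<omega> * (1 + (norm (q \<omega>))\<^sup>2) \<partial>M"
  have R: "?R = (\<integral>\<omega>. h \<omega> \<partial>M) + (\<integral>\<omega>. h \<omega> * (norm (q \<omega>))\<^sup>2 \<partial>M)"
    using ints by (simp add: distrib_left)
  have R0: "0 \<le> ?D" "0 \<le> ?R" "0 \<le> ?EW" using h by (auto intro!: integral_nonneg)
  have orth: "(\<integral>\<omega>. inner (h \<omega> *\<^sub>R (Y n \<omega> - q \<omega>)) (V n \<omega>) \<partial>M) = 0"
    unfolding V_def
    by (rule expectation_batch_noise_orthogonal[OF Y_adapted Y_square_integrable seen_half_subset backward_batch_new])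
       (use hh Y_adapted[of n] in \<open>auto intro!: square_integrable_weighted square_integrable_diff sq hM\<close>)
  have into: "integrable M (\<lambda>\<omega>. inner (h \<omega> *\<^sub>R (Y n \<omega> - q \<omega>)) (V n \<omega>))"
    by (intro integrable_inner square_integrable_weighted square_integrable_diff sq hM)
  have "(\<integral>\<omega>. h \<omega> * (norm (X (Suc n) \<omega> - q \<omega>))\<^sup>2 \<partial>M)
    \<le> (\<integral>\<omega>. h \<omega> * (norm (X n \<omega> - q \<omega>))\<^sup>2 - (1 - 2 * hi\<^sup>2 * L\<^sup>2) * (h \<omega> * (norm (X n \<omega> - Y n \<omega>))\<^sup>2)
        - 2 * \<alpha> n * inner (h \<omega> *\<^sub>R (Y n \<omega> - q \<omega>)) (V n \<omega>)
        + 4 * hi\<^sup>2 * (h \<omega> * (norm (W n \<omega>))\<^sup>2 + h \<omega> * (norm (V n \<omega>))\<^sup>2) \<partial>M)"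
  proof (rule integral_mono)
    fix \<omega>
    have "h \<omega> * (norm (X (Suc n) \<omega> - q \<omega>))\<^sup>2 \<le> h \<omega> * ((norm (X n \<omega> - q \<omega>))\<^sup>2 - (1 - 2 * hi\<^sup>2 * L\<^sup>2) * (norm (X n \<omega> - Y n \<omega>))\<^sup>2
           - 2 * \<alpha> n * inner (V n \<omega>) (Y n \<omega> - q \<omega>) + 4 * hi\<^sup>2 * ((norm (W n \<omega>))\<^sup>2 + (norm (V n \<omega>))\<^sup>2))"
      by (intro mult_left_mono fbf_step_inequality[OF K T_lip mono q(3) alpha_pos alpha(2) Y_eq X_Suc] h)
    then show "h \<omega> * (norm (X (Suc n) \<omega> - q \<omega>))\<^sup>2
      \<le> h \<omega> * (norm (X n \<omega> - q \<omega>))\<^sup>2 - (1 - 2 * hi\<^sup>2 * L\<^sup>2) * (h \<omega> * (norm (X n \<omega> - Y n \<omega>))\<^sup>2)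
        - 2 * \<alpha> n * inner (h \<omega> *\<^sub>R (Y n \<omega> - q \<omega>)) (V n \<omega>)
        + 4 * hi\<^sup>2 * (h \<omega> * (norm (W n \<omega>))\<^sup>2 + h \<omega> * (norm (V n \<omega>))\<^sup>2)"
      by (simp add: inner_commute[of "V n \<omega>"] right_diff_distrib distrib_left mult.left_commute)
  qed (use ints into in \<open>auto simp del: inner_scaleR_left\<close>)
  also have "\<dots> = ?D - (1 - 2 * hi\<^sup>2 * L\<^sup>2) * (\<integral>\<omega>. h \<omega> * (norm (X n \<omega> - Y n \<omega>))\<^sup>2 \<partial>M) + 4 * hi\<^sup>2 * (?EW + ?EV)"
    using ints into orth by (simp del: inner_scaleR_left)
  finally have main: "(\<integral>\<omega>. h \<omega> * (norm (X (Suc n) \<omega> - q \<omega>))\<^sup>2 \<partial>M)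
    \<le> ?D - (1 - 2 * hi\<^sup>2 * L\<^sup>2) * (\<integral>\<omega>. h \<omega> * (norm (X n \<omega> - Y n \<omega>))\<^sup>2 \<partial>M) + 4 * hi\<^sup>2 * (?EW + ?EV)" .
  have EX: "(\<integral>\<omega>. h \<omega> * (1 + (norm (X n \<omega>))\<^sup>2) \<partial>M) \<le> 2 * (?R + ?D)"
  proof -
    have "(\<integral>\<omega>. h \<omega> * (1 + (norm (X n \<omega>))\<^sup>2) \<partial>M) \<le> (\<integral>\<omega>. 2 * (h \<omega> * (1 + (norm (q \<omega>))\<^sup>2) + h \<omega> * (norm (X n \<omega> - q \<omega>))\<^sup>2) \<partial>M)"
    proof (rule integral_mono)
      fix \<omega>
      have "1 + (norm (X n \<omega>))\<^sup>2 \<le> 2 * ((1 + (norm (q \<omega>))\<^sup>2) + (norm (X n \<omega> - q \<omega>))\<^sup>2)"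
        using sq_norm_add_le[of "q \<omega>" "X n \<omega> - q \<omega>"] by simp
      from mult_left_mono[OF this h(2)[of \<omega>]]
      show "h \<omega> * (1 + (norm (X n \<omega>))\<^sup>2) \<le> 2 * (h \<omega> * (1 + (norm (q \<omega>))\<^sup>2) + h \<omega> * (norm (X n \<omega> - q \<omega>))\<^sup>2)"
        by (simp add: algebra_simps)
    qed (use ints in \<open>auto simp: distrib_left\<close>)
    also have "\<dots> = 2 * (?R + ?D)" using ints by (simp add: distrib_left)
    finally show ?thesis .
  qed
  have EY: "(\<integral>\<omega>. h \<omega> * (1 + (norm (Y n \<omega>))\<^sup>2) \<partial>M) \<le> 16 * (?R + ?D) + 4 * hi\<^sup>2 * ?EW"
  proof -
    have "(\<integral>\<omega>. h \<omega> * (1 + (norm (Y n \<omega>))\<^sup>2) \<partial>M) \<le> (\<integral>\<omega>. 16 * (h \<omega> * (1 + (norm (q \<omega>))\<^sup>2) + h \<omega> * (norm (X n \<omega> - q \<omega>))\<^sup>2)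
       + 4 * hi\<^sup>2 * (h \<omega> * (norm (W n \<omega>))\<^sup>2) \<partial>M)"
    proof (rule integral_mono)
      fix \<omega>
      have "(norm (Y n \<omega>))\<^sup>2 \<le> 2 * (norm (q \<omega>))\<^sup>2 + 16 * (norm (X n \<omega> - q \<omega>))\<^sup>2 + 4 * hi\<^sup>2 * (norm (W n \<omega>))\<^sup>2"
        by (rule fb_point_growth[OF K T_lip q(3) alpha_pos alpha(2) hi_L Y_eq])
      then have "1 + (norm (Y n \<omega>))\<^sup>2 \<le> 16 * ((1 + (norm (q \<omega>))\<^sup>2) + (norm (X n \<omega> - q \<omega>))\<^sup>2) + 4 * hi\<^sup>2 * (norm (W n \<omega>))\<^sup>2"
        using zero_le_power2[of "norm (q \<omega>)"] unfolding distrib_left by linarith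
      from mult_left_mono[OF this h(2)[of \<omega>]]
      show "h \<omega> * (1 + (norm (Y n \<omega>))\<^sup>2) \<le> 16 * (h \<omega> * (1 + (norm (q \<omega>))\<^sup>2) + h \<omega> * (norm (X n \<omega> - q \<omega>))\<^sup>2)
       + 4 * hi\<^sup>2 * (h \<omega> * (norm (W n \<omega>))\<^sup>2)"
        by (simp add: algebra_simps)
    qed (use ints in \<open>auto simp: distrib_left\<close>)
    also have "\<dots> = 16 * (?R + ?D) + 4 * hi\<^sup>2 * ?EW" using ints by (simp add: distrib_left)
    finally show ?thesis .
  qed
  have EW: "?EW \<le> C / k * (2 * (?R + ?D))"
    using expectation_W_sq_le[OF h] mult_left_mono[OF EX, of "C / k"] C0 k by (simp add: k_def)
  also have "\<dots> \<le> C * (2 * (?R + ?D))"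
    using C0 k R0 by (intro mult_right_mono) (auto simp: divide_le_eq mult_le_cancel_left1)
  finally have "4 * hi\<^sup>2 * ?EW \<le> 4 * hi\<^sup>2 * (C * (2 * (?R + ?D)))" by (intro mult_left_mono) auto
  with EY have "(\<integral>\<omega>. h \<omega> * (1 + (norm (Y n \<omega>))\<^sup>2) \<partial>M) \<le> (16 + 8 * hi\<^sup>2 * C) * (?R + ?D)"
    by (simp add: algebra_simps)
  from mult_left_mono[OF this, of "C / k"] expectation_V_sq_le[OF hh(1) h(2,3)]
  have EV: "?EV \<le> C / k * ((16 + 8 * hi\<^sup>2 * C) * (?R + ?D))"
    using C0 k by (simp add: k_def)
  have "?EW + ?EV \<le> C / k * ((18 + 8 * hi\<^sup>2 * C) * (?R + ?D))"
    using add_mono[OF EW EV] by (simp add: algebra_simps add_divide_distrib)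
  then have "4 * hi\<^sup>2 * (?EW + ?EV) \<le> 4 * hi\<^sup>2 * (C / k * ((18 + 8 * hi\<^sup>2 * C) * (?R + ?D)))"
    by (intro mult_left_mono) auto
  also have "\<dots> = \<gamma> n * (?R + ?D)" by (simp add: \<gamma>_def growth_const_def k_def)
  finally show ?thesis using main by (simp add: algebra_simps)
qed

end

context sfbf_square_integrable
begin

section \<open>Bounded moments and vanishing residuals\<close>

definition anchor :: "real^'d" where
  "anchor = (SOME q. q \<in> vi_solutions K T)"

lemma anchor: "anchor \<in> vi_solutions K T"
  unfolding anchor_def using sol by (simp add: some_in_eq)

text \<open>The Gronwall bound for \<open>E \<parallel>X n - anchor\<parallel>\<^sup>2 + 1 + \<parallel>anchor\<parallel>\<^sup>2\<close> over all times.\<close>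
definition moment_bound :: real where
  "moment_bound = ((\<integral>\<omega>. (norm (X 0 \<omega> - anchor))\<^sup>2 \<partial>M) + (1 + (norm anchor)\<^sup>2)) * exp (suminf \<gamma>)"

lemma X_anchor_integrable: "integrable M (\<lambda>\<omega>. (norm (X n \<omega> - anchor))\<^sup>2)"
  using square_integrable_diff[OF X_square_integrable square_integrable_const[OF finite_measure_axioms]]
  by (simp add: square_integrable_def)

lemma XY_integrable: "integrable M (\<lambda>\<omega>. (norm (X n \<omega> - Y n \<omega>))\<^sup>2)"
  using square_integrable_diff[OF X_square_integrable Y_square_integrable]
  by (simp add: square_integrable_def)

lemma anchored_step:
  "(\<integral>\<omega>. (norm (X (Suc n) \<omega> - anchor))\<^sup>2 \<partial>M) + (1 - 2 * hi\<^sup>2 * L\<^sup>2) * (\<integral>\<omega>. (norm (X n \<omega> - Y n \<omega>))\<^sup>2 \<partial>M)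
    \<le> (1 + \<gamma> n) * (\<integral>\<omega>. (norm (X n \<omega> - anchor))\<^sup>2 \<partial>M) + \<gamma> n * (1 + (norm anchor)\<^sup>2)"
  using expected_step[of "\<lambda>_. 1" n "\<lambda>_. anchor"] anchor finite_measure_axioms
  by (simp add: prob_space)

lemma mean_square_bound: "(\<integral>\<omega>. (norm (X n \<omega> - anchor))\<^sup>2 \<partial>M) + (1 + (norm anchor)\<^sup>2) \<le> moment_bound"
proof -
  let ?v = "\<lambda>n. \<integral>\<omega>. (norm (X n \<omega> - anchor))\<^sup>2 \<partial>M" and ?b = "1 + (norm anchor)\<^sup>2"
  have w: "0 \<le> (1 - 2 * hi\<^sup>2 * L\<^sup>2) * (\<integral>\<omega>. (norm (X n \<omega> - Y n \<omega>))\<^sup>2 \<partial>M)" for n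
    using hi by (intro mult_nonneg_nonneg integral_nonneg) auto
  have b: "0 \<le> ?v k + ?b" for k by (intro add_nonneg_nonneg integral_nonneg) auto
  have "?v n + ?b \<le> (?v 0 + ?b) * exp (\<Sum>k=0..<n. \<gamma> k)"
  proof (rule discrete_gronwall)
    show "?v (Suc k) \<le> (1 + \<gamma> k) * ?v k + \<gamma> k * ?b" for k
      using anchored_step[of k] w[of k] by linarith
  qed (use gamma_nonneg b in auto)
  also have "\<dots> \<le> moment_bound"
    unfolding moment_bound_def using gamma_nonneg b[of 0]
    by (intro mult_left_mono) (auto intro: sum_le_suminf[OF gamma_summable])
  finally show ?thesis .
qed

lemma moment_bound_nonneg: "0 \<le> moment_bound"
proof -
  have "0 \<le> (\<integral>\<omega>. (norm (X 0 \<omega> - anchor))\<^sup>2 \<partial>M) + (1 + (norm anchor)\<^sup>2)"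
    by (intro add_nonneg_nonneg integral_nonneg) auto
  also have "\<dots> \<le> moment_bound" by (rule mean_square_bound)
  finally show ?thesis .
qed

lemma X_sq_bound: "(\<integral>\<omega>. 1 + (norm (X n \<omega>))\<^sup>2 \<partial>M) \<le> 2 * moment_bound"
proof -
  have "(\<integral>\<omega>. 1 + (norm (X n \<omega>))\<^sup>2 \<partial>M) \<le> (\<integral>\<omega>. 2 * (norm (X n \<omega> - anchor))\<^sup>2 + 2 * (1 + (norm anchor)\<^sup>2) \<partial>M)"
  proof (rule integral_mono)
    show "1 + (norm (X n \<omega>))\<^sup>2 \<le> 2 * (norm (X n \<omega> - anchor))\<^sup>2 + 2 * (1 + (norm anchor)\<^sup>2)" for \<omega>
      using sq_norm_add_le[of "X n \<omega> - anchor" anchor] by simp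
  qed (use X_square_integrable X_anchor_integrable in \<open>auto simp: square_integrable_def\<close>)
  also have "\<dots> = 2 * ((\<integral>\<omega>. (norm (X n \<omega> - anchor))\<^sup>2 \<partial>M) + (1 + (norm anchor)\<^sup>2))"
    using X_anchor_integrable by (simp add: prob_space)
  also have "\<dots> \<le> 2 * moment_bound" by (intro mult_left_mono mean_square_bound) simp
  finally show ?thesis .
qed

text \<open>The expected step inequality telescopes: the decrease terms sum up to at most the initial
value plus the summable errors.\<close>
lemma XY_tendsto_0: "(\<lambda>n. \<integral>\<omega>. (norm (X n \<omega> - Y n \<omega>))\<^sup>2 \<partial>M) \<longlonglongrightarrow> 0"
proof -
  let ?d = "1 - 2 * hi\<^sup>2 * L\<^sup>2"
  let ?v = "\<lambda>n. \<integral>\<omega>. (norm (X n \<omega> - anchor))\<^sup>2 \<partial>M" and ?w = "\<lambda>n. \<integral>\<omega>. (norm (X n \<omega> - Y n \<omega>))\<^sup>2 \<partial>M"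
  have d: "?d > 0" using hi by simp
  have v0: "0 \<le> ?v k" and w0: "0 \<le> ?w k" for k by (auto intro!: integral_nonneg)
  have "?d * ?w k \<le> ?v k - ?v (Suc k) + \<gamma> k * moment_bound" for k
  proof -
    have "\<gamma> k * (?v k + (1 + (norm anchor)\<^sup>2)) \<le> \<gamma> k * moment_bound"
      using mean_square_bound gamma_nonneg by (intro mult_left_mono) auto
    then show ?thesis using anchored_step[of k] by (simp add: algebra_simps)
  qed
  then have "(\<Sum>k<n. ?d * ?w k) \<le> (\<Sum>k<n. ?v k - ?v (Suc k) + \<gamma> k * moment_bound)" for n
    by (intro sum_mono)
  moreover have "(\<Sum>k<n. ?v k - ?v (Suc k) + \<gamma> k * moment_bound) \<le> ?v 0 + suminf \<gamma> * moment_bound" for n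
  proof -
    have "(\<Sum>k<n. \<gamma> k) * moment_bound \<le> suminf \<gamma> * moment_bound"
      using gamma_nonneg moment_bound_nonneg by (intro mult_right_mono sum_le_suminf gamma_summable) auto
    moreover have "(\<Sum>k<n. ?v k - ?v (Suc k)) = ?v 0 - ?v n" by (rule sum_lessThan_telescope')
    ultimately show ?thesis
      using v0[of n] unfolding sum.distrib sum_distrib_right[symmetric] by linarith
  qed
  ultimately have "summable (\<lambda>k. ?d * ?w k)"
    using d w0 by (intro summableI_nonneg_bounded) (auto intro: order_trans)
  then have "summable ?w" using d by (simp add: summable_cmult_iff)
  then show ?thesis by (rule summable_LIMSEQ_zero)
qed

lemma W_tendsto_0: "(\<lambda>n. \<integral>\<omega>. (norm (W n \<omega>))\<^sup>2 \<partial>M) \<longlonglongrightarrow> 0"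
proof (rule tendsto_sandwich[where f = "\<lambda>_. 0"])
  show "\<forall>\<^sub>F n in sequentially. (\<integral>\<omega>. (norm (W n \<omega>))\<^sup>2 \<partial>M) \<le> (C * (2 * moment_bound)) * (1 / real (m (Suc n)))"
  proof (intro always_eventually allI)
    fix n
    have "(\<integral>\<omega>. (norm (W n \<omega>))\<^sup>2 \<partial>M) \<le> C / real (m (Suc n)) * (\<integral>\<omega>. 1 + (norm (X n \<omega>))\<^sup>2 \<partial>M)"
      using expectation_W_sq_le[of "\<lambda>_. 1" n] by simp
    also have "\<dots> \<le> C / real (m (Suc n)) * (2 * moment_bound)"
      using C0 by (intro mult_left_mono X_sq_bound) auto
    finally show "(\<integral>\<omega>. (norm (W n \<omega>))\<^sup>2 \<partial>M) \<le> (C * (2 * moment_bound)) * (1 / real (m (Suc n)))" by simp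
  qed
  show "(\<lambda>n. (C * (2 * moment_bound)) * (1 / real (m (Suc n)))) \<longlonglongrightarrow> 0"
    using summable_LIMSEQ_zero[OF m_sum] by (intro tendsto_mult_right_zero)
  show "\<forall>\<^sub>F n in sequentially. 0 \<le> (\<integral>\<omega>. (norm (W n \<omega>))\<^sup>2 \<partial>M)" by simp
qed simp

lemma residual_meas [measurable]: "(\<lambda>\<omega>. residual K T (\<alpha> n) (X n \<omega>)) \<in> borel_measurable M"
proof -
  have [measurable]: "closest_point K \<in> borel_measurable borel"
    using K K_nonempty by (rule projection_meas)
  show ?thesis unfolding residual_def by measurable
qed

lemma residual_sq_le: "(residual K T (\<alpha> n) (X n \<omega>))\<^sup>2 \<le> 2 * (norm (X n \<omega> - Y n \<omega>))\<^sup>2 + 2 * hi\<^sup>2 * (norm (W n \<omega>))\<^sup>2"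
  by (rule residual_le_step[OF K K_nonempty alpha_pos alpha(2)]) (rule Y_eq)

lemma residual_integrable: "integrable M (\<lambda>\<omega>. (residual K T (\<alpha> n) (X n \<omega>))\<^sup>2)"
proof (rule Bochner_Integration.integrable_bound)
  show "integrable M (\<lambda>\<omega>. 2 * (norm (X n \<omega> - Y n \<omega>))\<^sup>2 + 2 * hi\<^sup>2 * (norm (W n \<omega>))\<^sup>2)"
    using XY_integrable W_square_integrable by (auto simp: square_integrable_def)
  show "AE \<omega> in M. norm ((residual K T (\<alpha> n) (X n \<omega>))\<^sup>2) \<le> norm (2 * (norm (X n \<omega> - Y n \<omega>))\<^sup>2 + 2 * hi\<^sup>2 * (norm (W n \<omega>))\<^sup>2)"
    using residual_sq_le by (auto intro: order_trans)
qed measurable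

lemma residual_tendsto_0: "(\<lambda>n. \<integral>\<omega>. (residual K T (\<alpha> n) (X n \<omega>))\<^sup>2 \<partial>M) \<longlonglongrightarrow> 0"
proof (rule tendsto_sandwich[where f = "\<lambda>_. 0"])
  show "\<forall>\<^sub>F n in sequentially. (\<integral>\<omega>. (residual K T (\<alpha> n) (X n \<omega>))\<^sup>2 \<partial>M)
    \<le> 2 * (\<integral>\<omega>. (norm (X n \<omega> - Y n \<omega>))\<^sup>2 \<partial>M) + 2 * hi\<^sup>2 * (\<integral>\<omega>. (norm (W n \<omega>))\<^sup>2 \<partial>M)"
  proof (intro always_eventually allI)
    fix n
    have "integrable M (\<lambda>\<omega>. (norm (W n \<omega>))\<^sup>2)" using W_square_integrable by (simp add: square_integrable_def)
    then show "(\<integral>\<omega>. (residual K T (\<alpha> n) (X n \<omega>))\<^sup>2 \<partial>M)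
      \<le> 2 * (\<integral>\<omega>. (norm (X n \<omega> - Y n \<omega>))\<^sup>2 \<partial>M) + 2 * hi\<^sup>2 * (\<integral>\<omega>. (norm (W n \<omega>))\<^sup>2 \<partial>M)"
      using integral_mono[OF residual_integrable[of n] _ residual_sq_le[of n]] XY_integrable[of n] by simp
  qed
  show "(\<lambda>n. 2 * (\<integral>\<omega>. (norm (X n \<omega> - Y n \<omega>))\<^sup>2 \<partial>M) + 2 * hi\<^sup>2 * (\<integral>\<omega>. (norm (W n \<omega>))\<^sup>2 \<partial>M)) \<longlonglongrightarrow> 0"
    using tendsto_add[OF tendsto_mult_left[OF XY_tendsto_0, of 2] tendsto_mult_left[OF W_tendsto_0, of "2 * hi\<^sup>2"]] by simp
qed auto

lemma infdist_meas [measurable]: "(\<lambda>x. infdist x A) \<in> borel_measurable borel" for A :: "(real^'d) set"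
  by (intro borel_measurable_continuous_onI continuous_intros)

text \<open>Either \<open>X n\<close> is large, which the moment bound makes unlikely, or it lies in a fixed ball far from the solutions,
where the residual exceeds a positive constant, which the mean square convergence of the residual makes unlikely.\<close>
lemma infdist_to_solutions_in_probability:
  assumes \<rho>: "\<rho> > 0"
  shows "(\<lambda>n. prob {\<omega>\<in>space M. \<rho> \<le> infdist (X n \<omega>) (vi_solutions K T)}) \<longlonglongrightarrow> 0"
proof (rule LIMSEQ_I)
  fix e :: real assume e: "e > 0"
  \<comment> \<open>Chosen so that Markov's inequality gives \<open>\<parallel>X n\<parallel> > R\<close> probability below \<open>e / 2\<close>.\<close>
  define R where "R = sqrt (4 * moment_bound / e + 1)"
  have R2: "R\<^sup>2 = 4 * moment_bound / e + 1" "R > 0" unfolding R_def using moment_bound_nonneg e by (auto simp: add_nonneg_pos)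
  have "2 * moment_bound / R\<^sup>2 < e / 2"
  proof -
    have "2 * moment_bound < e / 2 * R\<^sup>2" using e by (simp add: R2 field_simps)
    then show ?thesis using R2(2) by (simp add: divide_less_eq)
  qed
  obtain r where r: "r > 0" "\<And>a x. a \<in> {lo..hi} \<Longrightarrow> norm x \<le> R \<Longrightarrow> \<rho> \<le> infdist x (vi_solutions K T) \<Longrightarrow> r \<le> residual K T a x"
    using residual_bounded_below[OF K K_nonempty T_cont lo \<rho>, of hi R] by blast
  have "(\<lambda>n. (\<integral>\<omega>. (residual K T (\<alpha> n) (X n \<omega>))\<^sup>2 \<partial>M) / r\<^sup>2) \<longlonglongrightarrow> 0"
    using residual_tendsto_0 by (rule tendsto_divide_zero)
  then have "\<forall>\<^sub>F n in sequentially. (\<integral>\<omega>. (residual K T (\<alpha> n) (X n \<omega>))\<^sup>2 \<partial>M) / r\<^sup>2 < e / 2"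
    by (rule order_tendstoD(2)) (use e in simp)
  then obtain n0 where n0: "\<And>n. n \<ge> n0 \<Longrightarrow> (\<integral>\<omega>. (residual K T (\<alpha> n) (X n \<omega>))\<^sup>2 \<partial>M) / r\<^sup>2 < e / 2"
    by (auto simp: eventually_sequentially)
  have "prob {\<omega>\<in>space M. \<rho> \<le> infdist (X n \<omega>) (vi_solutions K T)} < e" if "n \<ge> n0" for n
  proof -
    have iX: "integrable M (\<lambda>\<omega>. 1 + (norm (X n \<omega>))\<^sup>2)" using X_square_integrable by (auto simp: square_integrable_def)
    have "prob {\<omega>\<in>space M. \<rho> \<le> infdist (X n \<omega>) (vi_solutions K T)}
      \<le> prob ({\<omega>\<in>space M. R\<^sup>2 \<le> 1 + (norm (X n \<omega>))\<^sup>2} \<union> {\<omega>\<in>space M. r\<^sup>2 \<le> (residual K T (\<alpha> n) (X n \<omega>))\<^sup>2})"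
    proof (rule finite_measure_mono, intro subsetI)
      fix \<omega> assume w: "\<omega> \<in> {\<omega>\<in>space M. \<rho> \<le> infdist (X n \<omega>) (vi_solutions K T)}"
      show "\<omega> \<in> {\<omega>\<in>space M. R\<^sup>2 \<le> 1 + (norm (X n \<omega>))\<^sup>2} \<union> {\<omega>\<in>space M. r\<^sup>2 \<le> (residual K T (\<alpha> n) (X n \<omega>))\<^sup>2}"
      proof (cases "norm (X n \<omega>) \<le> R")
        case True
        then have "r \<le> residual K T (\<alpha> n) (X n \<omega>)" using w alpha by (intro r(2)) auto
        then show ?thesis using w r(1) by (auto intro: power_mono)
      next
        case False
        then have "R\<^sup>2 \<le> (norm (X n \<omega>))\<^sup>2" using R2(2) by (intro power_mono) auto
        then show ?thesis using w by auto
      qed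
    qed measurable
    also have "\<dots> \<le> prob {\<omega>\<in>space M. R\<^sup>2 \<le> 1 + (norm (X n \<omega>))\<^sup>2} + prob {\<omega>\<in>space M. r\<^sup>2 \<le> (residual K T (\<alpha> n) (X n \<omega>))\<^sup>2}"
      by (intro measure_Un_le) measurable
    also have "prob {\<omega>\<in>space M. R\<^sup>2 \<le> 1 + (norm (X n \<omega>))\<^sup>2} \<le> (\<integral>\<omega>. 1 + (norm (X n \<omega>))\<^sup>2 \<partial>M) / R\<^sup>2"
      using R2(2) by (intro integral_Markov_inequality_measure[where A = "{}"] iX) auto
    also have "\<dots> \<le> 2 * moment_bound / R\<^sup>2" by (intro divide_right_mono X_sq_bound) auto
    also have "\<dots> < e / 2" by fact
    also have "prob {\<omega>\<in>space M. r\<^sup>2 \<le> (residual K T (\<alpha> n) (X n \<omega>))\<^sup>2} \<le> (\<integral>\<omega>. (residual K T (\<alpha> n) (X n \<omega>))\<^sup>2 \<partial>M) / r\<^sup>2"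
      using r(1) by (intro integral_Markov_inequality_measure[where A = "{}"] residual_integrable) auto
    also have "\<dots> < e / 2" using n0[OF that] .
    finally show ?thesis by simp
  qed
  then show "\<exists>n0. \<forall>n\<ge>n0. norm (prob {\<omega>\<in>space M. \<rho> \<le> infdist (X n \<omega>) (vi_solutions K T)} - 0) < e"
    by auto
qed

section \<open>Almost sure convergence\<close>

text \<open>The reference solution is chosen at time \<open>n\<close>, so it depends on the path, but it is known from then on.\<close>
definition nearest :: "nat \<Rightarrow> 'w \<Rightarrow> real^'d" where
  "nearest n \<omega> = closest_point (vi_solutions K T) (X n \<omega>)"

lemma nearest_solution: "nearest n \<omega> \<in> vi_solutions K T"
  unfolding nearest_def by (rule closest_point_in_set[OF solutions_closed_convex(1) sol])

lemma nearest_adapted: "n \<le> k \<Longrightarrow> nearest n \<in> borel_measurable (past (seen k))"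
proof -
  assume nk: "n \<le> k"
  have [measurable]: "closest_point (vi_solutions K T) \<in> borel_measurable borel"
    using solutions_closed_convex sol by (intro projection_meas)
  have "seen n \<subseteq> seen k" using nk by (auto simp: seen_def)
  from measurable_past_mono[OF this X_adapted] have [measurable]: "X n \<in> borel_measurable (past (seen k))" .
  show ?thesis unfolding nearest_def[abs_def] by measurable
qed

lemma nearest_meas [measurable]: "nearest n \<in> borel_measurable M"
  using from_past[OF seen_subset nearest_adapted[OF order_refl]] .

lemma dist_nearest: "norm (X n \<omega> - nearest n \<omega>) = infdist (X n \<omega>) (vi_solutions K T)"
  unfolding nearest_def infdist_eq_setdist setdist_closest_point[OF solutions_closed_convex(1) sol] dist_norm ..

lemma nearest_sq_le: "1 + (norm (nearest n \<omega>))\<^sup>2 \<le> 2 * (norm (X n \<omega> - anchor))\<^sup>2 + 2 * (1 + (norm anchor)\<^sup>2)"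
proof -
  have "norm (nearest n \<omega> - anchor) \<le> norm (X n \<omega> - anchor)"
    using closest_point_lipschitz[OF solutions_closed_convex(2,1) sol, of "X n \<omega>" anchor] closest_point_self[OF anchor]
    by (simp add: nearest_def dist_norm)
  then have "(norm (nearest n \<omega> - anchor))\<^sup>2 \<le> (norm (X n \<omega> - anchor))\<^sup>2" by (rule power_mono) simp
  moreover have "(norm (nearest n \<omega>))\<^sup>2 \<le> 2 * (norm (nearest n \<omega> - anchor))\<^sup>2 + 2 * (norm anchor)\<^sup>2"
    using sq_norm_add_le[of "nearest n \<omega> - anchor" anchor] by simp
  moreover have "1 + c \<le> 2 * a + 2 * (1 + b)" if "a' \<le> a" "c \<le> 2 * a' + 2 * b" for a a' b c :: real
    using that by simp
  ultimately show ?thesis by blast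
qed

lemma nearest_square_integrable: "square_integrable M (nearest n)"
proof (rule square_integrable_bound)
  show "integrable M (\<lambda>\<omega>. 2 * (norm (X n \<omega> - anchor))\<^sup>2 + 2 * (1 + (norm anchor)\<^sup>2))"
    using X_anchor_integrable by auto
  show "(norm (nearest n \<omega>))\<^sup>2 \<le> 2 * (norm (X n \<omega> - anchor))\<^sup>2 + 2 * (1 + (norm anchor)\<^sup>2)" for \<omega>
    using nearest_sq_le[of n \<omega>] by linarith
qed measurable

lemma nearest_sq_bound: "(\<integral>\<omega>. 1 + (norm (nearest n \<omega>))\<^sup>2 \<partial>M) \<le> 2 * moment_bound"
proof -
  have "(\<integral>\<omega>. 1 + (norm (nearest n \<omega>))\<^sup>2 \<partial>M) \<le> (\<integral>\<omega>. 2 * (norm (X n \<omega> - anchor))\<^sup>2 + 2 * (1 + (norm anchor)\<^sup>2) \<partial>M)"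
    by (rule integral_mono)
      (use nearest_sq_le nearest_square_integrable X_anchor_integrable in \<open>auto simp: square_integrable_def\<close>)
  also have "\<dots> = 2 * ((\<integral>\<omega>. (norm (X n \<omega> - anchor))\<^sup>2 \<partial>M) + (1 + (norm anchor)\<^sup>2))"
    using X_anchor_integrable by (simp add: prob_space)
  also have "\<dots> \<le> 2 * moment_bound" by (intro mult_left_mono mean_square_bound) simp
  finally show ?thesis .
qed

text \<open>The maximal inequality from time \<open>n\<close> on, applied to the squared distance to the solution nearest to \<open>X n\<close> and started on the
event that this distance is below \<open>\<rho>\<close> at time \<open>n\<close>. As \<open>n\<close> grows, the exponential tends to one, and
the probability is then at most about \<open>\<rho>\<^sup>2 / e\<close>.\<close>
lemma excursion_probability:
  assumes \<rho>: "0 \<le> \<rho>" and e: "0 < e"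
  shows "e * prob {\<omega>\<in>space M. infdist (X n \<omega>) (vi_solutions K T) < \<rho> \<and> (\<exists>k\<ge>n. e \<le> (norm (X k \<omega> - nearest n \<omega>))\<^sup>2)} + 2 * moment_bound
    \<le> (\<rho>\<^sup>2 + 2 * moment_bound) * exp (\<Sum>k. \<gamma> (k + n))"
proof -
  let ?V = "\<lambda>k \<omega>. (norm (X k \<omega> - nearest n \<omega>))\<^sup>2"
  let ?G = "{\<omega>\<in>space M. infdist (X n \<omega>) (vi_solutions K T) < \<rho>}"
  let ?E = "\<lambda>N. {\<omega>\<in>?G. \<exists>k\<in>{n..N}. e \<le> ?V k \<omega>}"
  have intV: "integrable M (?V k)" for k
    using square_integrable_diff[OF X_square_integrable nearest_square_integrable] by (simp add: square_integrable_def)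
  have GH: "?G \<in> sets (past (seen n))"
  proof -
    have [measurable]: "X n \<in> borel_measurable (past (seen n))" by (rule X_adapted)
    have "{\<omega>\<in>space (past (seen n)). infdist (X n \<omega>) (vi_solutions K T) < \<rho>} \<in> sets (past (seen n))" by measurable
    then show ?thesis by simp
  qed
  have "e * prob (?E N) + 2 * moment_bound \<le> (\<rho>\<^sup>2 + 2 * moment_bound) * exp (\<Sum>k. \<gamma> (k + n))" if nN: "n \<le> N" for N
  proof -
    have "e * prob (?E N) + 2 * moment_bound \<le> ((\<integral>\<omega>. indicator ?G \<omega> * ?V n \<omega> \<partial>M) + 2 * moment_bound) * exp (\<Sum>k=n..<N. \<gamma> k)"
    proof (rule almost_supermartingale_maximal_inequality[where H = "\<lambda>k. past (seen k)"])
      show "subalgebra M (past (seen k))" for k by (rule subalgebra_past[OF seen_subset])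
      show "sets (past (seen k)) \<subseteq> sets (past (seen (Suc k)))" for k by (rule past_mono[OF seen_Suc])
      show "?V k \<in> borel_measurable (past (seen k))" if "n \<le> k" for k
      proof -
        have [measurable]: "X k \<in> borel_measurable (past (seen k))" by (rule X_adapted)
        have [measurable]: "nearest n \<in> borel_measurable (past (seen k))" using that by (rule nearest_adapted)
        show ?thesis by measurable
      qed
      show "integrable M (?V k)" for k by (rule intV)
      fix k A assume k: "n \<le> k" and A: "A \<in> sets (past (seen k))"
      let ?h = "indicator A :: 'w \<Rightarrow> real"
      have AM: "A \<in> sets M" using A subalgebra_past[OF seen_subset, of k] by (auto simp: subalgebra_def)
      have "0 \<le> (1 - 2 * hi\<^sup>2 * L\<^sup>2) * (\<integral>\<omega>. ?h \<omega> * (norm (X k \<omega> - Y k \<omega>))\<^sup>2 \<partial>M)"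
        using hi by (intro mult_nonneg_nonneg integral_nonneg) auto
      moreover have "(\<integral>\<omega>. ?h \<omega> * ?V (Suc k) \<omega> \<partial>M) + (1 - 2 * hi\<^sup>2 * L\<^sup>2) * (\<integral>\<omega>. ?h \<omega> * (norm (X k \<omega> - Y k \<omega>))\<^sup>2 \<partial>M)
        \<le> (1 + \<gamma> k) * (\<integral>\<omega>. ?h \<omega> * ?V k \<omega> \<partial>M) + \<gamma> k * (\<integral>\<omega>. ?h \<omega> * (1 + (norm (nearest n \<omega>))\<^sup>2) \<partial>M)"
        using A by (intro expected_step nearest_adapted[OF k] nearest_square_integrable nearest_solution)
          (auto simp: indicator_def)
      moreover have "(\<integral>\<omega>. ?h \<omega> * (1 + (norm (nearest n \<omega>))\<^sup>2) \<partial>M) \<le> 2 * moment_bound"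
      proof -
        have i: "integrable M (\<lambda>\<omega>. 1 + (norm (nearest n \<omega>))\<^sup>2)"
          using nearest_square_integrable by (auto simp: square_integrable_def)
        have "(\<integral>\<omega>. ?h \<omega> * (1 + (norm (nearest n \<omega>))\<^sup>2) \<partial>M) \<le> (\<integral>\<omega>. 1 + (norm (nearest n \<omega>))\<^sup>2 \<partial>M)"
          using AM by (intro integral_mono integrable_weighted i) (auto simp: indicator_def)
        then show ?thesis using nearest_sq_bound[of n] by linarith
      qed
      then have "\<gamma> k * (\<integral>\<omega>. ?h \<omega> * (1 + (norm (nearest n \<omega>))\<^sup>2) \<partial>M) \<le> \<gamma> k * (2 * moment_bound)"
        using gamma_nonneg by (intro mult_left_mono)
      ultimately show "(\<integral>\<omega>. ?h \<omega> * ?V (Suc k) \<omega> \<partial>M) \<le> (1 + \<gamma> k) * (\<integral>\<omega>. ?h \<omega> * ?V k \<omega> \<partial>M) + \<gamma> k * (2 * moment_bound)"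
        by linarith
    qed (use GH gamma_nonneg moment_bound_nonneg e nN in auto)
    also have "\<dots> \<le> (\<rho>\<^sup>2 + 2 * moment_bound) * exp (\<Sum>k. \<gamma> (k + n))"
    proof (intro mult_mono add_right_mono)
      have "(\<integral>\<omega>. indicator ?G \<omega> * ?V n \<omega> \<partial>M) \<le> (\<integral>\<omega>. \<rho>\<^sup>2 \<partial>M)"
      proof (rule integral_mono)
        show "integrable M (\<lambda>\<omega>. indicator ?G \<omega> * ?V n \<omega>)"
          by (intro integrable_weighted intV) (auto simp: indicator_def)
        show "indicator ?G \<omega> * ?V n \<omega> \<le> \<rho>\<^sup>2" for \<omega>
          unfolding dist_nearest by (auto simp: indicator_def infdist_nonneg intro: power_mono)
      qed simp
      then show "(\<integral>\<omega>. indicator ?G \<omega> * ?V n \<omega> \<partial>M) \<le> \<rho>\<^sup>2" by (simp add: prob_space)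
      have "(\<Sum>k=n..<N. \<gamma> k) = (\<Sum>k<N-n. \<gamma> (k + n))"
        using nN by (intro sum.reindex_bij_witness[of _ "\<lambda>k. k + n" "\<lambda>k. k - n"]) auto
      also have "\<dots> \<le> (\<Sum>k. \<gamma> (k + n))"
        using gamma_nonneg gamma_summable by (intro sum_le_suminf) (auto simp: summable_iff_shift)
      finally show "exp (\<Sum>k=n..<N. \<gamma> k) \<le> exp (\<Sum>k. \<gamma> (k + n))" by simp
    qed (use moment_bound_nonneg in auto)
    finally show ?thesis .
  qed
  moreover have "(\<lambda>N. e * prob (?E N) + 2 * moment_bound) \<longlonglongrightarrow> e * prob (\<Union>N. ?E N) + 2 * moment_bound"
    by (intro tendsto_intros finite_Lim_measure_incseq) (auto simp: incseq_def intro: order_trans)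
  ultimately have "e * prob (\<Union>N. ?E N) + 2 * moment_bound \<le> (\<rho>\<^sup>2 + 2 * moment_bound) * exp (\<Sum>k. \<gamma> (k + n))"
    by (intro LIMSEQ_le_const2) auto
  also have "(\<Union>N. ?E N) = {\<omega>\<in>space M. infdist (X n \<omega>) (vi_solutions K T) < \<rho> \<and> (\<exists>k\<ge>n. e \<le> ?V k \<omega>)}"
    by auto (meson atLeastAtMost_iff order_refl)
  finally show ?thesis .
qed

lemma leaves_nearest_in_probability:
  assumes e: "e > 0"
  shows "(\<lambda>n. prob {\<omega>\<in>space M. \<exists>k\<ge>n. e \<le> dist (X k \<omega>) (nearest n \<omega>)}) \<longlonglongrightarrow> 0"
proof (rule LIMSEQ_I)
  fix \<eta> :: real assume \<eta>: "\<eta> > 0"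
  \<comment> \<open>The excursion bound at the level \<open>e\<^sup>2\<close> tends to \<open>\<rho>\<^sup>2 / e\<^sup>2\<close>, which this choice makes \<open>\<eta> / 2\<close>.\<close>
  define \<rho> where "\<rho> = e * sqrt (\<eta> / 2)"
  have \<rho>: "\<rho> > 0" "\<rho>\<^sup>2 / e\<^sup>2 = \<eta> / 2" using e \<eta> by (auto simp: \<rho>_def power_mult_distrib)
  let ?bad = "\<lambda>n. prob {\<omega>\<in>space M. \<rho> \<le> infdist (X n \<omega>) (vi_solutions K T)}"
  let ?exc = "\<lambda>n. ((\<rho>\<^sup>2 + 2 * moment_bound) * exp (\<Sum>k. \<gamma> (k + n)) - 2 * moment_bound) / e\<^sup>2"
  have "(\<lambda>n. ?bad n + ?exc n) \<longlonglongrightarrow> 0 + ((\<rho>\<^sup>2 + 2 * moment_bound) * exp 0 - 2 * moment_bound) / e\<^sup>2"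
    using e by (intro tendsto_intros infdist_to_solutions_in_probability[OF \<rho>(1)] suminf_exist_split2[OF gamma_summable]) auto
  also have "0 + ((\<rho>\<^sup>2 + 2 * moment_bound) * exp 0 - 2 * moment_bound) / e\<^sup>2 = \<eta> / 2" using \<rho>(2) by simp
  finally have "\<forall>\<^sub>F n in sequentially. ?bad n + ?exc n < \<eta>" by (rule order_tendstoD(2)) (use \<eta> in simp)
  then obtain n0 where n0: "\<And>n. n \<ge> n0 \<Longrightarrow> ?bad n + ?exc n < \<eta>" by (auto simp: eventually_sequentially)
  have "prob {\<omega>\<in>space M. \<exists>k\<ge>n. e \<le> dist (X k \<omega>) (nearest n \<omega>)} < \<eta>" if "n \<ge> n0" for n
  proof -
    let ?E = "{\<omega>\<in>space M. infdist (X n \<omega>) (vi_solutions K T) < \<rho> \<and> (\<exists>k\<ge>n. e\<^sup>2 \<le> (norm (X k \<omega> - nearest n \<omega>))\<^sup>2)}"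
    have "prob {\<omega>\<in>space M. \<exists>k\<ge>n. e \<le> dist (X k \<omega>) (nearest n \<omega>)}
      \<le> prob ({\<omega>\<in>space M. \<rho> \<le> infdist (X n \<omega>) (vi_solutions K T)} \<union> ?E)"
    proof (rule finite_measure_mono, intro subsetI)
      fix \<omega> assume w: "\<omega> \<in> {\<omega>\<in>space M. \<exists>k\<ge>n. e \<le> dist (X k \<omega>) (nearest n \<omega>)}"
      then obtain k where k: "k \<ge> n" "e \<le> norm (X k \<omega> - nearest n \<omega>)" by (auto simp: dist_norm)
      then have "e\<^sup>2 \<le> (norm (X k \<omega> - nearest n \<omega>))\<^sup>2" using e by (intro power_mono) auto
      with w k show "\<omega> \<in> {\<omega>\<in>space M. \<rho> \<le> infdist (X n \<omega>) (vi_solutions K T)} \<union> ?E"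
        by (auto simp: not_le)
    qed measurable
    also have "\<dots> \<le> ?bad n + prob ?E" by (intro measure_Un_le) measurable
    also have "prob ?E \<le> ?exc n"
      using excursion_probability[of \<rho> "e\<^sup>2" n] \<rho>(1) e by (simp add: pos_le_divide_eq mult.commute)
    also have "?bad n + ?exc n < \<eta>" using n0[OF that] .
    finally show ?thesis by simp
  qed
  then show "\<exists>n0. \<forall>n\<ge>n0. norm (prob {\<omega>\<in>space M. \<exists>k\<ge>n. e \<le> dist (X k \<omega>) (nearest n \<omega>)} - 0) < \<eta>" by auto
qed

theorem AE_converges_to_solution: "AE \<omega> in M. \<exists>x\<in>vi_solutions K T. (\<lambda>n. X n \<omega>) \<longlonglongrightarrow> x"
proof -
  have "AE \<omega> in M. \<forall>e>0. \<exists>n. \<forall>k\<ge>n. dist (X k \<omega>) (nearest n \<omega>) < e"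
    by (rule AE_eventually_close[OF X_meas nearest_meas leaves_nearest_in_probability])
  then show ?thesis
  proof eventually_elim
    case (elim \<omega>)
    then show ?case
      by (intro convergent_to_closed_if_eventually_close[where q = "\<lambda>n. nearest n \<omega>"]
        solutions_closed_convex(1) nearest_solution) blast
  qed
qed

end

section \<open>Reduction to the regular case\<close>

text \<open>The pointwise inequality \<open>t\<^sup>2 \<le> a\<^sup>2 (1 + (t / a) powr p)\<close> bounds the second moment by the \<open>p\<close>-th one.\<close>
lemma (in prob_space) second_moment_le_of_moment:
  fixes D :: "'a \<Rightarrow> 'b::euclidean_space"
  assumes p: "p \<ge> 2" and a: "a > 0" and int: "integrable M (\<lambda>\<omega>. norm (D \<omega>) powr p)"
    and le: "(\<integral>\<omega>. norm (D \<omega>) powr p \<partial>M) powr (1 / p) \<le> a"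
  shows "(\<integral>\<^sup>+\<omega>. ennreal ((norm (D \<omega>))\<^sup>2) \<partial>M) \<le> ennreal (2 * a\<^sup>2)"
proof -
  let ?I = "\<integral>\<omega>. norm (D \<omega>) powr p \<partial>M"
  have I0: "0 \<le> ?I" by (intro Bochner_Integration.integral_nonneg) auto
  have "?I = (?I powr (1 / p)) powr p" using p I0 by (simp add: powr_powr)
  also have "\<dots> \<le> a powr p" using p le by (intro powr_mono2) auto
  finally have I: "?I \<le> a powr p" .
  have pw: "t\<^sup>2 \<le> a\<^sup>2 + a\<^sup>2 / (a powr p) * (t powr p)" if t: "0 \<le> t" for t
  proof (cases "t \<le> a")
    case True
    then have "t\<^sup>2 \<le> a\<^sup>2" using t by (intro power_mono)
    moreover have "0 \<le> a\<^sup>2 / (a powr p) * (t powr p)" using a by simp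
    ultimately show ?thesis by linarith
  next
    case False
    then have ta: "1 \<le> t / a" using a by simp
    have "(t / a) powr 2 \<le> (t / a) powr p" using p ta by (rule powr_mono)
    then have "(t / a)\<^sup>2 \<le> t powr p / a powr p" using a t ta by (simp add: powr_divide power_divide)
    then have "a\<^sup>2 * (t / a)\<^sup>2 \<le> a\<^sup>2 * (t powr p / a powr p)" by (rule mult_left_mono) simp
    then have "t\<^sup>2 \<le> a\<^sup>2 / (a powr p) * (t powr p)" using a by (simp add: power_divide)
    then show ?thesis using zero_le_power2[of a] by linarith
  qed
  have int': "integrable M (\<lambda>\<omega>. a\<^sup>2 + a\<^sup>2 / (a powr p) * (norm (D \<omega>) powr p))"
    using int by (intro Bochner_Integration.integrable_add integrable_mult_right) auto
  have "(\<integral>\<^sup>+\<omega>. ennreal ((norm (D \<omega>))\<^sup>2) \<partial>M) \<le> (\<integral>\<^sup>+\<omega>. ennreal (a\<^sup>2 + a\<^sup>2 / (a powr p) * (norm (D \<omega>) powr p)) \<partial>M)"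
    by (intro nn_integral_mono ennreal_leI pw) simp
  also have "\<dots> = ennreal (\<integral>\<omega>. a\<^sup>2 + a\<^sup>2 / (a powr p) * (norm (D \<omega>) powr p) \<partial>M)"
    by (intro nn_integral_eq_integral int') auto
  also have "(\<integral>\<omega>. a\<^sup>2 + a\<^sup>2 / (a powr p) * (norm (D \<omega>) powr p) \<partial>M) = a\<^sup>2 + a\<^sup>2 / (a powr p) * ?I"
    using int by (subst Bochner_Integration.integral_add) (auto simp: prob_space)
  also have "\<dots> \<le> 2 * a\<^sup>2"
    using mult_left_mono[OF I, of "a\<^sup>2 / (a powr p)"] a by simp
  finally show ?thesis by (simp add: ennreal_leI)
qed

lemma indep_rvs_compose:
  assumes M: "prob_space M" and ind: "indep_rvs M N V N' W" and f: "f \<in> N \<rightarrow>\<^sub>M N''"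
  shows "indep_rvs M N'' (\<lambda>\<omega>. f (V \<omega>)) N' W"
proof -
  interpret prob_space M by fact
  have V: "V \<in> M \<rightarrow>\<^sub>M N" using ind by (simp add: indep_rvs_def)
  have fV: "(\<lambda>\<omega>. f (V \<omega>)) \<in> M \<rightarrow>\<^sub>M N''" by (rule measurable_compose[OF V f])
  have "sets (vimage_algebra (space M) (\<lambda>\<omega>. f (V \<omega>)) N'') \<subseteq> sets (vimage_algebra (space M) V N)"
  proof
    fix E assume "E \<in> sets (vimage_algebra (space M) (\<lambda>\<omega>. f (V \<omega>)) N'')"
    then obtain A where A: "A \<in> sets N''" "E = (\<lambda>\<omega>. f (V \<omega>)) -` A \<inter> space M"
      using measurable_space[OF fV] by (subst (asm) sets_vimage_algebra2) auto
    have "E = V -` (f -` A \<inter> space N) \<inter> space M" using A measurable_space[OF V] by auto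
    also have "\<dots> \<in> sets (vimage_algebra (space M) V N)"
      by (intro in_vimage_algebra measurable_sets[OF f] A)
    finally show "E \<in> sets (vimage_algebra (space M) V N)" .
  qed
  then show ?thesis using ind fV unfolding indep_rvs_def indep_sets2_eq by blast
qed

lemma sfbf_path_cong:
  assumes "\<And>n x. minibatch F (m (Suc n)) (u (Suc n)) x = minibatch F' (m (Suc n)) (u (Suc n)) x"
    and "\<And>n x. minibatch F (m (Suc n)) (v (Suc n)) x = minibatch F' (m (Suc n)) (v (Suc n)) x"
  shows "sfbf_path K F \<alpha> m x u v n = sfbf_path K F' \<alpha> m x u v n"
  by (induction n) (simp_all add: Let_def forward_backward_def assms)

text \<open>The first claim concerns an arbitrary starting point. For each natural number \<open>R\<close> the process started at
\<open>X 0\<close> cut off outside the ball of radius \<open>R\<close> converges almost surely and agrees with the original one as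
long as \<open>\<parallel>X 0\<parallel> \<le> R\<close>. Altering \<open>F\<close> on a null set \<open>N\<close> that contains all samples with a discontinuity makes the
iterates measurable, so that the limit can be defined from them on the whole space.\<close>
theorem theorem4p5:
  fixes M :: "'w measure" and S :: "'z measure" and xi :: "'w \<Rightarrow> 'z"
    and K :: "(real^'d) set" and F :: "real^'d \<Rightarrow> 'z \<Rightarrow> real^'d"
    and T :: "real^'d \<Rightarrow> real^'d" and K_sol :: "(real^'d) set"
    and L :: real and \<alpha> :: "nat \<Rightarrow> real" and m :: "nat \<Rightarrow> nat"
    and p \<sigma>\<^sub>0 :: real and \<sigma> :: "real^'d \<Rightarrow> real"
    and xs es :: "nat \<Rightarrow> nat \<Rightarrow> 'w \<Rightarrow> 'z"
    and X Y A B :: "nat \<Rightarrow> 'w \<Rightarrow> real^'d"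
  defines "T \<equiv> mean_operator M xi F"
    and "K_sol \<equiv> vi_solutions K T"
  assumes prob: "prob_space M"
    and xi: "xi \<in> M \<rightarrow>\<^sub>M S"
    and F_int: "\<And>x. integrable M (\<lambda>\<omega>. F x (xi \<omega>))"
    and A1: "K_sol \<noteq> {}"
    and A2_set: "K \<noteq> {}" "closed K" "convex K"
    and A2_cont: "AE z in distr M S xi. continuous_on UNIV (\<lambda>x. F x z)"
    and A2_meas: "\<And>x. F x \<in> borel_measurable S"
    and A3: "L > 0" "L-lipschitz_on UNIV T"
    and A4: "pseudo_monotone T"
    and A5_bdd: "bdd_below (range \<alpha>)" "bdd_above (range \<alpha>)"
    and A5: "0 < (INF n. \<alpha> n)" "(SUP n. \<alpha> n) < 1 / (sqrt 2 * L)"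
    and A6_pos: "\<And>n. n \<ge> 1 \<Longrightarrow> m n \<ge> 1"
    and A6_sum: "summable (\<lambda>n. 1 / real (m (Suc n)))"
    and A7_const: "p \<ge> 2" "\<sigma>\<^sub>0 \<ge> 0"
    and A7_nonneg: "\<And>x. x \<in> K_sol \<Longrightarrow> \<sigma> x \<ge> 0"
    and A7_meas: "\<sigma> \<in> borel_measurable (restrict_space borel K_sol)"
    and A7_loc_bdd: "\<And>x. x \<in> K_sol \<Longrightarrow> \<exists>e>0. bounded (\<sigma> ` (K_sol \<inter> ball x e))"
    and A7_int: "\<And>x. integrable M (\<lambda>\<omega>. norm (F x (xi \<omega>) - T x) powr p)"
    and A7: "\<And>x x_sol. x_sol \<in> K_sol \<Longrightarrow>
        (\<integral>\<omega>. norm (F x (xi \<omega>) - T x) powr p \<partial>M) powr (1 / p) \<le> \<sigma> x_sol + \<sigma>\<^sub>0 * norm (x - x_sol)"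
    and X0: "X 0 \<in> borel_measurable M"
    and samples_indep:
      "prob_space.indep_vars M (\<lambda>_. S) (samples xs es) (sample_indices m)"
    and samples_law:
      "\<And>j. j \<in> sample_indices m \<Longrightarrow> distr M S (samples xs es j) = distr M S xi"
    and X0_indep:
      "indep_rvs M borel (X 0) (PiM (sample_indices m) (\<lambda>_. S))
         (\<lambda>\<omega>. \<lambda>j\<in>sample_indices m. samples xs es j \<omega>)"
    and SFBF_A: "\<And>n \<omega>. \<omega> \<in> space M \<Longrightarrow>
        A (Suc n) \<omega> = minibatch F (m (Suc n)) (\<lambda>i. xs (Suc n) i \<omega>) (X n \<omega>)"
    and SFBF_Y: "\<And>n \<omega>. \<omega> \<in> space M \<Longrightarrow>
        Y n \<omega> = closest_point K (X n \<omega> - \<alpha> n *\<^sub>R A (Suc n) \<omega>)"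
    and SFBF_B: "\<And>n \<omega>. \<omega> \<in> space M \<Longrightarrow>
        B (Suc n) \<omega> = minibatch F (m (Suc n)) (\<lambda>i. es (Suc n) i \<omega>) (Y n \<omega>)"
    and SFBF_X: "\<And>n \<omega>. \<omega> \<in> space M \<Longrightarrow>
        X (Suc n) \<omega> = Y n \<omega> + \<alpha> n *\<^sub>R (A (Suc n) \<omega> - B (Suc n) \<omega>)"
  shows "(\<exists>X_lim. X_lim \<in> borel_measurable M \<and> (\<forall>\<omega>\<in>space M. X_lim \<omega> \<in> K_sol) \<and>
            (AE \<omega> in M. (\<lambda>n. X n \<omega>) \<longlonglongrightarrow> X_lim \<omega>))
       \<and> (integrable M (\<lambda>\<omega>. (norm (X 0 \<omega>))\<^sup>2) \<longrightarrow>
            (\<lambda>n. \<integral>\<^sup>+\<omega>. ennreal ((residual K T (\<alpha> n) (X n \<omega>))\<^sup>2) \<partial>M) \<longlonglongrightarrow> 0)"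
proof -
  interpret prob_space M by (rule prob)
  define P where "P = distr M S xi"
  interpret P: prob_space P unfolding P_def using xi by (rule prob_space_distr)
  have sP [simp]: "sets P = sets S" "space P = space S" by (simp_all add: P_def)
  have T_eq: "T x = (\<integral>\<omega>. F x (xi \<omega>) \<partial>M)" for x by (simp add: T_def mean_operator_def)

  obtain N where N: "{z \<in> space P. \<not> continuous_on UNIV (\<lambda>x. F x z)} \<subseteq> N" "emeasure P N = 0" "N \<in> sets P"
    using A2_cont unfolding P_def[symmetric] by (rule AE_E)
  have N_S [measurable]: "N \<in> sets S" using N(3) by simp
  define F' where "F' x z = (if z \<in> N then 0 else F x z)" for x z
  have F'_meas: "F' x \<in> borel_measurable S" for x
    unfolding F'_def[abs_def] using A2_meas[of x] by measurable
  have AE_N: "AE z in P. z \<notin> N" using N by (intro AE_not_in null_setsI)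
  have F'_AE: "AE z in P. F x z = F' x z" for x using AE_N by eventually_elim (simp add: F'_def)
  have F_P [measurable]: "F x \<in> borel_measurable P" "F' x \<in> borel_measurable P" for x
    using A2_meas F'_meas by (simp_all cong: measurable_cong_sets)

  obtain q where q: "q \<in> K_sol" using A1 by blast
  define c where "c = \<sigma> q + \<sigma>\<^sub>0 * norm q + 1"
  define C where "C = 2 * (2 * c\<^sup>2 + 2 * \<sigma>\<^sub>0\<^sup>2)"
  \<comment> \<open>One fixed solution \<open>q\<close> turns the moment assumption into a bound of quadratic growth. The summand
    \<open>1\<close> in \<open>a\<close> keeps it positive.\<close>
  have variance: "(\<integral>\<^sup>+z. ennreal ((norm (F' x z - T x))\<^sup>2) \<partial>P) \<le> ennreal (C * (1 + (norm x)\<^sup>2))" for x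
  proof -
    define a where "a = \<sigma> q + \<sigma>\<^sub>0 * norm (x - q) + 1"
    have a: "a > 0" using A7_nonneg[OF q] A7_const by (auto simp: a_def intro: add_nonneg_pos)
    have "(\<integral>\<^sup>+z. ennreal ((norm (F' x z - T x))\<^sup>2) \<partial>P) = (\<integral>\<^sup>+z. ennreal ((norm (F x z - T x))\<^sup>2) \<partial>P)"
      using F'_AE[of x] by (intro nn_integral_cong_AE) (auto elim: eventually_mono)
    also have "\<dots> = (\<integral>\<^sup>+\<omega>. ennreal ((norm (F x (xi \<omega>) - T x))\<^sup>2) \<partial>M)"
      unfolding P_def using xi A2_meas[of x] by (subst nn_integral_distr) auto
    also have "\<dots> \<le> ennreal (2 * a\<^sup>2)"
      using A7[OF q, of x] by (intro second_moment_le_of_moment[OF A7_const(1) a A7_int]) (simp add: a_def)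
    also have "2 * a\<^sup>2 \<le> C * (1 + (norm x)\<^sup>2)"
    proof -
      have "a \<le> c + \<sigma>\<^sub>0 * norm x"
        using mult_left_mono[OF norm_triangle_ineq4[of x q] A7_const(2)] by (simp add: a_def c_def algebra_simps)
      then have "a\<^sup>2 \<le> (c + \<sigma>\<^sub>0 * norm x)\<^sup>2" using a by (intro power_mono) auto
      also have "\<dots> \<le> 2 * c\<^sup>2 + 2 * \<sigma>\<^sub>0\<^sup>2 * (norm x)\<^sup>2"
        using sq_norm_add_le[of c "\<sigma>\<^sub>0 * norm x"] by (simp add: power_mult_distrib)
      also have "\<dots> \<le> (2 * c\<^sup>2 + 2 * \<sigma>\<^sub>0\<^sup>2) * (1 + (norm x)\<^sup>2)" by (simp add: algebra_simps)
      finally show ?thesis by (simp add: C_def algebra_simps)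
    qed
    finally show ?thesis by (simp add: ennreal_leI)
  qed

  define lo where "lo = (INF n. \<alpha> n)"
  define hi where "hi = (SUP n. \<alpha> n)"
  have alpha: "lo \<le> \<alpha> n" "\<alpha> n \<le> hi" for n
    unfolding lo_def hi_def using A5_bdd by (auto intro: cINF_lower cSUP_upper)
  have lo: "lo > 0" using A5(1) by (simp add: lo_def)
  have hi: "2 * hi\<^sup>2 * L\<^sup>2 < 1"
  proof -
    have "0 < hi" using alpha[of 0] lo by linarith
    then have "0 \<le> hi * (sqrt 2 * L)" using A3(1) by simp
    moreover have "hi * (sqrt 2 * L) < 1" using A5(2) A3(1) unfolding hi_def[symmetric] by (simp add: pos_less_divide_eq)
    ultimately have "(hi * (sqrt 2 * L))\<^sup>2 < 1" by (simp add: power_less_one_iff abs_square_less_1)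
    then show ?thesis by (simp add: power_mult_distrib mult_ac)
  qed

  have sfbf: "sfbf M x0 S P m xs es F' T L C K \<alpha> lo hi"
    if "indep_rvs M borel x0 (PiM (sample_indices m) (\<lambda>_. S)) (\<lambda>\<omega>. \<lambda>j\<in>sample_indices m. samples xs es j \<omega>)" for x0
  proof unfold_locales
    show "indep_vars (\<lambda>_. S) (samples xs es) (sample_indices m)" by (rule samples_indep)
    show "distr M S (samples xs es j) = P" if "j \<in> sample_indices m" for j
      using samples_law[OF that] by (simp add: P_def)
    show "(\<lambda>(x, z). F' x z) \<in> borel_measurable (borel \<Otimes>\<^sub>M S)"
    proof (rule caratheodory_measurable[OF _ F'_meas])
      show "continuous_on UNIV (\<lambda>x. F' x z)" if "z \<in> space S" for z
        using N(1) that by (cases "z \<in> N") (auto simp: F'_def)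
    qed
    show int: "integrable P (F' x)" for x
    proof -
      have "integrable P (F x)" using F_int[of x] xi A2_meas[of x] by (simp add: P_def integrable_distr_eq)
      then show ?thesis using integrable_cong_AE[OF F_P F'_AE] by blast
    qed
    show "(\<integral>z. F' x z \<partial>P) = T x" for x
    proof -
      have "(\<integral>z. F' x z \<partial>P) = (\<integral>z. F x z \<partial>P)" using integral_cong_AE[OF F_P F'_AE] by simp
      also have "\<dots> = T x" using xi A2_meas[of x] by (simp add: P_def integral_distr T_eq)
      finally show ?thesis .
    qed
  qed (use that variance A3 A2_set A4 A1 lo alpha hi A6_pos A6_sum in \<open>auto simp: C_def K_sol_def\<close>)

  have X_path: "X n \<omega> = sfbf_path K F \<alpha> m (X 0 \<omega>) (\<lambda>k i. xs k i \<omega>) (\<lambda>k i. es k i \<omega>) n" if "\<omega> \<in> space M" for n \<omega>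
    using that by (induction n) (simp_all add: Let_def forward_backward_def SFBF_A SFBF_B SFBF_X SFBF_Y)
  have AE_path: "AE \<omega> in M. \<forall>n. X n \<omega> = sfbf_path K F' \<alpha> m (X 0 \<omega>) (\<lambda>k i. xs k i \<omega>) (\<lambda>k i. es k i \<omega>) n"
  proof -
    have "AE \<omega> in M. samples xs es j \<omega> \<notin> N" if j: "j \<in> sample_indices m" for j
    proof -
      have "samples xs es j \<in> M \<rightarrow>\<^sub>M S" using samples_indep j by (simp add: indep_vars_def2)
      moreover have "AE z in distr M S (samples xs es j). z \<notin> N"
        unfolding samples_law[OF j] P_def[symmetric] by (rule AE_N)
      ultimately show ?thesis by (simp add: AE_distr_iff)
    qed
    then have "AE \<omega> in M. \<forall>j\<in>sample_indices m. samples xs es j \<omega> \<notin> N"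
      by (simp add: AE_ball_countable)
    then show ?thesis using AE_space
    proof eventually_elim
      case (elim \<omega>)
      have "xs (Suc n) i \<omega> \<notin> N" "es (Suc n) i \<omega> \<notin> N" if "i \<in> {1..m (Suc n)}" for n i
      proof -
        have "Inl (Suc n, i) \<in> sample_indices m" "Inr (Suc n, i) \<in> sample_indices m"
          using that by (auto simp: sample_indices_def batch_indices_def)
        then show "xs (Suc n) i \<omega> \<notin> N" "es (Suc n) i \<omega> \<notin> N"
          using elim(1) by (fastforce simp: samples_def)+
      qed
      then show ?case
        by (intro allI, subst X_path[OF elim(2)], intro sfbf_path_cong) (simp_all add: minibatch_def F'_def)
    qed
  qed

  interpret full: sfbf M "X 0" S P m xs es F' T L C K \<alpha> lo hi
    using X0_indep by (rule sfbf)
  have AE_full: "AE \<omega> in M. \<forall>n. X n \<omega> = full.X n \<omega>"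
    using AE_path by (simp add: full.X_def)
  have K_sol_closed: "closed K_sol" using full.solutions_closed_convex(1) by (simp add: K_sol_def)

  have "AE \<omega> in M. norm (X 0 \<omega>) \<le> real R \<longrightarrow> (\<exists>x\<in>K_sol. (\<lambda>n. full.X n \<omega>) \<longlonglongrightarrow> x)" for R :: nat
  proof -
    let ?f = "\<lambda>x :: real^'d. if norm x \<le> real R then x else 0"
    have f: "?f \<in> borel \<rightarrow>\<^sub>M borel" by measurable
    have cut_indep: "indep_rvs M borel (\<lambda>\<omega>. ?f (X 0 \<omega>)) (PiM (sample_indices m) (\<lambda>_. S))
        (\<lambda>\<omega>. \<lambda>j\<in>sample_indices m. samples xs es j \<omega>)"
      by (rule indep_rvs_compose[OF prob X0_indep f])
    interpret cut: sfbf_square_integrable M "\<lambda>\<omega>. ?f (X 0 \<omega>)" S P m xs es F' T L C K \<alpha> lo hi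
    proof (rule sfbf_square_integrable.intro[OF sfbf[OF cut_indep]], unfold_locales)
      show "square_integrable M (\<lambda>\<omega>. ?f (X 0 \<omega>))"
      proof (rule square_integrable_bound[where u = "\<lambda>_. (real R)\<^sup>2"])
        show "(\<lambda>\<omega>. ?f (X 0 \<omega>)) \<in> borel_measurable M" using X0 by measurable
        show "(norm (?f (X 0 \<omega>)))\<^sup>2 \<le> (real R)\<^sup>2" for \<omega> by (auto intro: power_mono)
      qed simp
    qed
    show ?thesis using cut.AE_converges_to_solution
      by eventually_elim (auto simp: cut.X_def full.X_def K_sol_def)
  qed
  then have "AE \<omega> in M. \<forall>R :: nat. norm (X 0 \<omega>) \<le> real R \<longrightarrow> (\<exists>x\<in>K_sol. (\<lambda>n. full.X n \<omega>) \<longlonglongrightarrow> x)"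
    by (simp only: AE_all_countable) simp
  then have conv: "AE \<omega> in M. \<exists>x\<in>K_sol. (\<lambda>n. full.X n \<omega>) \<longlonglongrightarrow> x"
    by eventually_elim (meson real_arch_simple)

  \<comment> \<open>Outside the event of convergence the limit is replaced by the solution \<open>q\<close>.\<close>
  define X_lim where "X_lim \<omega> = (if lim (\<lambda>n. full.X n \<omega>) \<in> K_sol then lim (\<lambda>n. full.X n \<omega>) else q)" for \<omega>
  have "X_lim \<in> borel_measurable M"
  proof -
    have [measurable]: "K_sol \<in> sets borel" using K_sol_closed by simp
    show ?thesis unfolding X_lim_def[abs_def] by measurable
  qed
  moreover have "\<forall>\<omega>\<in>space M. X_lim \<omega> \<in> K_sol" using q by (simp add: X_lim_def)
  moreover have "AE \<omega> in M. (\<lambda>n. X n \<omega>) \<longlonglongrightarrow> X_lim \<omega>"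
    using conv AE_full by eventually_elim (auto simp: X_lim_def limI)
  ultimately have part1: "\<exists>X_lim. X_lim \<in> borel_measurable M \<and> (\<forall>\<omega>\<in>space M. X_lim \<omega> \<in> K_sol) \<and>
            (AE \<omega> in M. (\<lambda>n. X n \<omega>) \<longlonglongrightarrow> X_lim \<omega>)" by blast

  have part2: "(\<lambda>n. \<integral>\<^sup>+\<omega>. ennreal ((residual K T (\<alpha> n) (X n \<omega>))\<^sup>2) \<partial>M) \<longlonglongrightarrow> 0"
    if X0_sq: "integrable M (\<lambda>\<omega>. (norm (X 0 \<omega>))\<^sup>2)"
  proof -
    interpret sq: sfbf_square_integrable M "X 0" S P m xs es F' T L C K \<alpha> lo hi
      by unfold_locales (use X0 X0_sq in \<open>simp add: square_integrable_def\<close>)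
    have "(\<integral>\<^sup>+\<omega>. ennreal ((residual K T (\<alpha> n) (X n \<omega>))\<^sup>2) \<partial>M)
      = ennreal (\<integral>\<omega>. (residual K T (\<alpha> n) (full.X n \<omega>))\<^sup>2 \<partial>M)" for n
    proof -
      have "(\<integral>\<^sup>+\<omega>. ennreal ((residual K T (\<alpha> n) (X n \<omega>))\<^sup>2) \<partial>M)
        = (\<integral>\<^sup>+\<omega>. ennreal ((residual K T (\<alpha> n) (full.X n \<omega>))\<^sup>2) \<partial>M)"
        using AE_full by (intro nn_integral_cong_AE) (auto elim: eventually_mono)
      also have "\<dots> = ennreal (\<integral>\<omega>. (residual K T (\<alpha> n) (full.X n \<omega>))\<^sup>2 \<partial>M)"
        by (intro nn_integral_eq_integral sq.residual_integrable) auto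
      finally show ?thesis .
    qed
    moreover have "(\<lambda>n. ennreal (\<integral>\<omega>. (residual K T (\<alpha> n) (full.X n \<omega>))\<^sup>2 \<partial>M)) \<longlonglongrightarrow> ennreal 0"
      by (intro tendsto_ennrealI sq.residual_tendsto_0)
    ultimately show ?thesis by simp
  qed
  show ?thesis using part1 part2 by blast
qed

end
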